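(* Let $\alpha\in\mathbb R$, let $\kappa\in\mathbb N_0\cup\{+\infty\}$, let $(s_j)_{j=0}^\kappa$ be a sequence of complex $q\times q$ matrices, and let $k$ be an integer with $0\le k\le\kappa$. Let $(s_j^{[k,\alpha]})_{j=0}^{\kappa-k}$ be the $k$-th $\alpha$-Schur transform of $(s_j)_{j=0}^\kappa$. Then: (a) If $(s_j)_{j=0}^\kappa\in\mathcal K^{\ge}_{q,\kappa,\alpha}$, then $(s_j^{[k,\alpha]})_{j=0}^{\kappa-k}\in\mathcal K^{\ge}_{q,\kappa-k,\alpha}$. (b) If $(s_j)_{j=0}^\kappa\in\mathcal K^{\ge,e}_{q,\kappa,\alpha}$, then $(s_j^{[k,\alpha]})_{j=0}^{\kappa-k}\in\mathcal K^{\ge,e}_{q,\kappa-k,\alpha}$. (c) If $(s_j)_{j=0}^\kappa\in\mathcal K^{>}_{q,\kappa,\alpha}$, then $(s_j^{[k,\alpha]})_{j=0}^{\kappa-k}\in\mathcal K^{>}_{q,\kappa-k,\alpha}$. (d) If $m$ is an integer with $0\le m\le\kappa$ and $(s_j)_{j=0}^\kappa\in\mathcal K^{\ge,cd,m}_{q,\kappa,\alpha}$, then $(s_j^{[k,\alpha]})_{j=0}^{\kappa-k}\in\mathcal K^{\ge,cd,\max\{0,m-k\}}_{q,\kappa-k,\alpha}$. (e) If $(s_j)_{j=0}^\kappa\in\mathcal K^{\ge,cd}_{q,\kappa,\alpha}$, then $(s_j^{[k,\alpha]})_{j=0}^{\kappa-k}\in\mathcal K^{\ge,cd}_{q,\k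appa-k,\alpha}$.
   Context: Let $q\in\mathbb N=\{1,2,\dots\}$; $\mathbb N_0=\{0,1,2,\dots\}$. All sequences consist of complex $q\times q$ matrices; $(s_j)_{j=0}^{\infty}$ is indexed by $\mathbb N_0$, and $\infty-k=\infty$. $A\ge0$ (resp. $A>0$) means that $A$ is nonnegative (resp. positive) Hermitian, i.e. Hermitian positive semidefinite (resp. definite), and $A^\dagger$ is the Moore–Penrose inverse of $A$. Block Hankel matrices. For a sequence $(s_j)$ put $H_n=[s_{j+k}]_{j,k=0}^n$, $s_{\alpha,j}=-\alpha s_j+s_{j+1}$, and $H_{\alpha,n}=[s_{\alpha,j+k}]_{j,k=0}^n$ (whenever the entries are available). Put $L_0=s_0$ and, for $n\ge1$, $L_n=s_{2n}-[s_n,\dots,s_{2n-1}]\,H_{n-1}^\dagger\,\begin{bmatrix}s_n\\ \vdots\\ s_{2n-1}\end{bmatrix}$; let $L_{\alpha,n}$ be the matrix built in the same way from $(s_{\alpha,j})$ in place of $(s_j)$ (so $L_{\alpha,0}=s_{\alpha,0}$). Classes. $\mathcal K^{\ge}_{q,0,\alpha}$: all $(s_j)_{j=0}^0$ with $s_0\ge0$. For $n\ge1$, $\mathcal K^{\ge}_{q,2n,\alpha}$: all $(s_j)_{j=0}^{2n}$ with $H_n\ge0$ and $H_{\alpha,n-1}\ge0$. For $n\ge0$, $\mathcal K^{\ge}_{q,2n+1,\alpha}$: all $(s_j)_{j=0}^{2n+1}$ with $H_n\ge0$ and $H_{\alpha,n}\ge0$. $\mathcal K^{>}_{q,m,\alpha}$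 is defined in the same way with $>0$ in place of $\ge0$ everywhere. $\mathcal K^{\ge}_{q,\infty,\alpha}$ (resp. $\mathcal K^{>}_{q,\infty,\alpha}$): all $(s_j)_{j=0}^\infty$ with $(s_j)_{j=0}^m\in\mathcal K^{\ge}_{q,m,\alpha}$ (resp. $\mathcal K^{>}_{q,m,\alpha}$) for all $m\in\mathbb N_0$. For $m\in\mathbb N_0$, $\mathcal K^{\ge,e}_{q,m,\alpha}$: all $(s_j)_{j=0}^m$ for which there is a complex $q\times q$ matrix $s_{m+1}$ with $(s_j)_{j=0}^{m+1}\in\mathcal K^{\ge}_{q,m+1,\alpha}$; $\mathcal K^{\ge,e}_{q,\infty,\alpha}=\mathcal K^{\ge}_{q,\infty,\alpha}$. For $n\ge0$, $\mathcal K^{\ge,cd}_{q,2n,\alpha}$: all $(s_j)_{j=0}^{2n}\in\mathcal K^{\ge}_{q,2n,\alpha}$ with $L_n=0$; $\mathcal K^{\ge,cd}_{q,2n+1,\alpha}$: all $(s_j)_{j=0}^{2n+1}\in\mathcal K^{\ge}_{q,2n+1,\alpha}$ with $L_{\alpha,n}=0$; $\mathcal K^{\ge,cd}_{q,\infty,\alpha}$: all $(s_j)_{j=0}^\infty\in\mathcal K^{\ge}_{q,\infty,\alpha}$ for which there is $m\in\mathbb N_0$ with $(s_j)_{j=0}^m\in\mathcal K^{\ge,cd}_{q,m,\alpha}$. For an integer $0\le m\le\kappa$, $\mathcal K^{\ge,cd,m}_{q,\kappa,\alpha}$: all $(s_j)_{j=0}^\kappa\in\mathcal K^{\ge}_{q,\kappa,\alpha}$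 with $(s_j)_{j=0}^m\in\mathcal K^{\ge,cd}_{q,m,\alpha}$. $\alpha$-Schur transforms. The $[+,\alpha]$-transform of $(s_j)$ is $(u_j)$ with $u_j=-\alpha s_{j-1}+s_j$, where $s_{-1}=0$. The reciprocal sequence of a sequence $(u_j)$ is given by $u_0^\sharp=u_0^\dagger$ and $u_j^\sharp=-u_0^\dagger\sum_{l=0}^{j-1}u_{j-l}u_l^\sharp$ for $j\ge1$. Put $s_j^{\sharp,\alpha}=u_j^\sharp$ where $(u_j)$ is the $[+,\alpha]$-transform of $(s_j)$. The first $\alpha$-Schur transform of a sequence $(s_j)_{j=0}^{\kappa}$ with $\kappa\ge1$ is $(s_j^{[1,\alpha]})_{j=0}^{\kappa-1}$ with $s_j^{[1,\alpha]}=-s_0\,s_{j+1}^{\sharp,\alpha}\,s_0$. The $0$-th $\alpha$-Schur transform of $(s_j)$ is $(s_j)$ itself, and for integers $1\le k\le\kappa$ the $k$-th $\alpha$-Schur transform $(s_j^{[k,\alpha]})_{j=0}^{\kappa-k}$ is the first $\alpha$-Schur transform of the $(k-1)$-th one. *)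

theory Defs
  imports
    "HOL-Library.Extended_Nat"
    "Jordan_Normal_Form.Matrix"
    "Jordan_Normal_Form.Schur_Decomposition"
begin

text \<open>
  A sequence \<open>(s\<^sub>j)\<close>, \<open>j = 0, \<dots>, \<kappa>\<close>, of complex \<open>q \<times> q\<close> matrices is represented by a total
  function \<^typ>\<open>nat \<Rightarrow> complex mat\<close> together with its last index \<open>\<kappa>\<close>, an \<^typ>\<open>enat\<close>. The values
  beyond \<open>\<kappa>\<close> are irrelevant: every class below constrains only the entries up to its length
  index, and the entry \<open>j\<close> of the \<open>k\<close>-th Schur transform depends only on the entries up to \<open>j + k\<close>.
\<close>

definition nonneg_hermitian :: "nat \<Rightarrow> complex mat \<Rightarrow> bool" where
  "nonneg_hermitian n A \<longleftrightarrow>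
     A \<in> carrier_mat n n \<and> mat_adjoint A = A \<and>
     (\<forall>v \<in> carrier_vec n. 0 \<le> Re ((A *\<^sub>v v) \<bullet>c v))"

definition pos_hermitian :: "nat \<Rightarrow> complex mat \<Rightarrow> bool" where
  "pos_hermitian n A \<longleftrightarrow>
     A \<in> carrier_mat n n \<and> mat_adjoint A = A \<and>
     (\<forall>v \<in> carrier_vec n. v \<noteq> 0\<^sub>v n \<longrightarrow> 0 < Re ((A *\<^sub>v v) \<bullet>c v))"

text \<open>The Moore--Penrose inverse is the unique solution of the four Penrose equations.\<close>

definition mp_inverse :: "complex mat \<Rightarrow> complex mat" where
  "mp_inverse A = (THE X. X \<in> carrier_mat (dim_col A) (dim_row A) \<and>
     A * X * A = A \<and> X * A * X = X \<and>
     mat_adjoint (A * X) = A * X \<and> mat_adjoint (X * A) = X * A)"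

definition block_mat :: "nat \<Rightarrow> nat \<Rightarrow> nat \<Rightarrow> (nat \<Rightarrow> nat \<Rightarrow> complex mat) \<Rightarrow> complex mat" where
  "block_mat q m n B = mat (m * q) (n * q) (\<lambda>(a, b). B (a div q) (b div q) $$ (a mod q, b mod q))"

definition hankel :: "nat \<Rightarrow> (nat \<Rightarrow> complex mat) \<Rightarrow> nat \<Rightarrow> complex mat" where
  "hankel q s n = block_mat q (Suc n) (Suc n) (\<lambda>j k. s (j + k))"

definition shifted :: "real \<Rightarrow> (nat \<Rightarrow> complex mat) \<Rightarrow> nat \<Rightarrow> complex mat" where
  "shifted \<alpha> s j = (- complex_of_real \<alpha>) \<cdot>\<^sub>m s j + s (Suc j)"

definition hankel_schur :: "nat \<Rightarrow> (nat \<Rightarrow> complex mat) \<Rightarrow> nat \<Rightarrow> complex mat" where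
  "hankel_schur q s n =
     (if n = 0 then s 0
      else s (2 * n) - block_mat q 1 n (\<lambda>_ k. s (n + k)) * mp_inverse (hankel q s (n - 1))
                         * block_mat q n 1 (\<lambda>j _. s (n + j)))"

text \<open>
  In the classes below a length index \<open>m\<close> of type \<^typ>\<open>nat\<close> is \<open>2n\<close> or \<open>2n + 1\<close> with
  \<open>n = m div 2\<close>. For \<open>m = 0\<close> the condition is \<open>s\<^sub>0 \<ge> 0\<close> (resp. \<open>s\<^sub>0 > 0\<close>), as the block
  Hankel matrix of index \<open>0\<close> is \<open>s\<^sub>0\<close>.
\<close>

definition stieltjes_nonneg_fin :: "nat \<Rightarrow> nat \<Rightarrow> real \<Rightarrow> (nat \<Rightarrow> complex mat) \<Rightarrow> bool" where
  "stieltjes_nonneg_fin q m \<alpha> s \<longleftrightarrow>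
     (\<forall>j \<le> m. s j \<in> carrier_mat q q) \<and>
     (let n = m div 2 in
        nonneg_hermitian (Suc n * q) (hankel q s n) \<and>
        (if even m
         then n \<ge> 1 \<longrightarrow> nonneg_hermitian (n * q) (hankel q (shifted \<alpha> s) (n - 1))
         else nonneg_hermitian (Suc n * q) (hankel q (shifted \<alpha> s) n)))"

definition stieltjes_pos_fin :: "nat \<Rightarrow> nat \<Rightarrow> real \<Rightarrow> (nat \<Rightarrow> complex mat) \<Rightarrow> bool" where
  "stieltjes_pos_fin q m \<alpha> s \<longleftrightarrow>
     (\<forall>j \<le> m. s j \<in> carrier_mat q q) \<and>
     (let n = m div 2 in
        pos_hermitian (Suc n * q) (hankel q s n) \<and>
        (if even m
         then n \<ge> 1 \<longrightarrow> pos_hermitian (n * q) (hankel q (shifted \<alpha> s) (n - 1))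
         else pos_hermitian (Suc n * q) (hankel q (shifted \<alpha> s) n)))"

definition stieltjes_nonneg :: "nat \<Rightarrow> enat \<Rightarrow> real \<Rightarrow> (nat \<Rightarrow> complex mat) \<Rightarrow> bool" where
  "stieltjes_nonneg q \<kappa> \<alpha> s =
     (case \<kappa> of enat m \<Rightarrow> stieltjes_nonneg_fin q m \<alpha> s
              | \<infinity> \<Rightarrow> (\<forall>m. stieltjes_nonneg_fin q m \<alpha> s))"

definition stieltjes_pos :: "nat \<Rightarrow> enat \<Rightarrow> real \<Rightarrow> (nat \<Rightarrow> complex mat) \<Rightarrow> bool" where
  "stieltjes_pos q \<kappa> \<alpha> s =
     (case \<kappa> of enat m \<Rightarrow> stieltjes_pos_fin q m \<alpha> s
              | \<infinity> \<Rightarrow> (\<forall>m. stieltjes_pos_fin q m \<alpha> s))"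

definition stieltjes_nonneg_ext :: "nat \<Rightarrow> enat \<Rightarrow> real \<Rightarrow> (nat \<Rightarrow> complex mat) \<Rightarrow> bool" where
  "stieltjes_nonneg_ext q \<kappa> \<alpha> s =
     (case \<kappa> of enat m \<Rightarrow> (\<exists>X \<in> carrier_mat q q. stieltjes_nonneg_fin q (Suc m) \<alpha> (s(Suc m := X)))
              | \<infinity> \<Rightarrow> stieltjes_nonneg q \<infinity> \<alpha> s)"

definition stieltjes_cd_fin :: "nat \<Rightarrow> nat \<Rightarrow> real \<Rightarrow> (nat \<Rightarrow> complex mat) \<Rightarrow> bool" where
  "stieltjes_cd_fin q m \<alpha> s \<longleftrightarrow>
     stieltjes_nonneg_fin q m \<alpha> s \<and>
     (if even m then hankel_schur q s (m div 2) = 0\<^sub>m q q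
      else hankel_schur q (shifted \<alpha> s) (m div 2) = 0\<^sub>m q q)"

definition stieltjes_cd :: "nat \<Rightarrow> enat \<Rightarrow> real \<Rightarrow> (nat \<Rightarrow> complex mat) \<Rightarrow> bool" where
  "stieltjes_cd q \<kappa> \<alpha> s =
     (case \<kappa> of enat m \<Rightarrow> stieltjes_cd_fin q m \<alpha> s
              | \<infinity> \<Rightarrow> stieltjes_nonneg q \<infinity> \<alpha> s \<and> (\<exists>m. stieltjes_cd_fin q m \<alpha> s))"

definition stieltjes_cd_order :: "nat \<Rightarrow> nat \<Rightarrow> enat \<Rightarrow> real \<Rightarrow> (nat \<Rightarrow> complex mat) \<Rightarrow> bool" where
  "stieltjes_cd_order q m \<kappa> \<alpha> s \<longleftrightarrow> stieltjes_nonneg q \<kappa> \<alpha> s \<and> stieltjes_cd_fin q m \<alpha> s"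

definition plus_transform :: "nat \<Rightarrow> real \<Rightarrow> (nat \<Rightarrow> complex mat) \<Rightarrow> nat \<Rightarrow> complex mat" where
  "plus_transform q \<alpha> s j =
     (- complex_of_real \<alpha>) \<cdot>\<^sub>m (if j = 0 then 0\<^sub>m q q else s (j - 1)) + s j"

text \<open>
  The type \<^typ>\<open>complex mat\<close> has no zero (the dimension is not part of the type), so the sum of
  matrices in the recursion is written entrywise.
\<close>

fun reciprocal :: "nat \<Rightarrow> (nat \<Rightarrow> complex mat) \<Rightarrow> nat \<Rightarrow> complex mat" where
  "reciprocal q u j =
     (if j = 0 then mp_inverse (u 0)
      else - (mp_inverse (u 0)
              * mat q q (\<lambda>(a, b). \<Sum>l\<in>{..<j}. (u (j - l) * reciprocal q u l) $$ (a, b))))"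

declare reciprocal.simps [simp del]

definition schur_transform1 :: "nat \<Rightarrow> real \<Rightarrow> (nat \<Rightarrow> complex mat) \<Rightarrow> nat \<Rightarrow> complex mat" where
  "schur_transform1 q \<alpha> s j = - (s 0 * reciprocal q (plus_transform q \<alpha> s) (Suc j) * s 0)"

primrec schur_transform :: "nat \<Rightarrow> real \<Rightarrow> nat \<Rightarrow> (nat \<Rightarrow> complex mat) \<Rightarrow> nat \<Rightarrow> complex mat" where
  "schur_transform q \<alpha> 0 s = s"
| "schur_transform q \<alpha> (Suc k) s = schur_transform1 q \<alpha> (schur_transform q \<alpha> k s)"

end

theory Submission
  imports
    Defs
    "HOL-Library.Function_Algebras"
    "HOL-Computational_Algebra.Formal_Power_Series"
    "Jordan_Normal_Form.Determinant"
begin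

text \<open>
  All five claims follow by iteration from one step of the algorithm, and one step is a pair of
  congruences between block Hankel matrices.

  Let \<open>p\<close> be the orthogonal projection onto the range of \<open>s\<^sub>0\<close>. The reciprocal sequence does not
  change when every \<open>s\<^sub>j\<close> is replaced by its compression \<open>p s\<^sub>j p\<close>. Let \<open>S\<close> be the generating
  series of the compressions, let \<open>U = (1 - \<alpha> x) S\<close>, and let \<open>V\<close> be the series of the
  reciprocal sequence, so that \<open>U V = V U = p\<close>. The Schur transform has the series \<open>T\<close> with \<open>x T = s\<^sub>0 - s\<^sub>0 V s\<^sub>0\<close>. The Hankel
  matrix of the compressions of the shifted sequence \<open>(- \<alpha> s\<^sub>j + s\<^sub>j\<^sub>+\<^sub>1)\<close> has the generating
  function \<open>(U x - U y) / (x - y)\<close>, and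
  \<open>V x * (U x - U y) * V y = - (V x - V y)\<close> shows that multiplying it by the triangular block Toeplitz
  matrix of \<open>s\<^sub>0 V\<close> and its adjoint gives the Hankel matrix of \<open>T\<close> (\<open>kernel_t\<close>). In the same way,
  \<open>W = (1 - \<alpha> x) V\<close> is reciprocal to \<open>S\<close>, and
  \<open>W x * (x S x - y S y) * W y = x W y - y W x\<close> shows that the matrix of \<open>s\<^sub>0 W\<close> transforms
  the Hankel matrix of \<open>S\<close> into the block diagonal matrix of \<open>s\<^sub>0\<close> and the Hankel matrix of the shifted
  sequence of \<open>T\<close> (\<open>bordered_eq\<close>). So the two Hankel matrices that define membership of \<open>T\<close>
  at length \<open>m\<close> come from the two that define membership of \<open>S\<close> at length \<open>m + 1\<close>.

  The triangular factors have \<open>s\<^sub>0 V\<^sub>0 = p\<close> on the diagonal. As they only act on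
  compressions, \<open>p\<close> may be replaced by \<open>1\<close> there, and the congruences become
  invertible (\<open>toeplitz_congruence\<close>). Nonnegativity passes to compressions, and positivity does
  because \<open>p\<close> is then injective. Complete degeneracy, \<open>L\<^sub>n = 0\<close>, means that every last component can
  be completed to a vector on which the form vanishes (\<open>hankel_schur_eq_0_iff\<close>); it passes to the
  compression because nonnegativity forces the range of every \<open>s\<^sub>j\<close> except the last one into the
  range of \<open>s\<^sub>0\<close> (\<open>stieltjes_dominated\<close>).
\<close>

section \<open>The ring of linear operators on complex sequences\<close>

text \<open>
  Matrices of every size act on complex sequences through finitely many coordinates. Inside the
  ring of all linear operators, products of rectangular blocks need no dimension bookkeeping, and
  power series with matrix coefficients become power series over one ring.
\<close>

typedef lop =
  "{f :: (nat \<Rightarrow> complex) \<Rightarrow> nat \<Rightarrow> complex.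
     (\<forall>x y. f (x + y) = f x + f y) \<and> (\<forall>c x. f (\<lambda>i. c * x i) = (\<lambda>i. c * f x i))}"
  morphisms app Lop
  by (rule exI[of _ "\<lambda>x. x"]) simp

setup_lifting type_definition_lop

instantiation lop :: ring_1
begin

lift_definition zero_lop :: lop is "\<lambda>x i. 0"
  by (auto simp: fun_eq_iff)

lift_definition one_lop :: lop is "\<lambda>x. x"
  by auto

lift_definition plus_lop :: "lop \<Rightarrow> lop \<Rightarrow> lop" is "\<lambda>f g x. f x + g x"
  by (auto simp: fun_eq_iff algebra_simps)

lift_definition uminus_lop :: "lop \<Rightarrow> lop" is "\<lambda>f x i. - f x i"
  by (auto simp: fun_eq_iff)

lift_definition minus_lop :: "lop \<Rightarrow> lop \<Rightarrow> lop" is "\<lambda>f g x i. f x i - g x i"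
  by (auto simp: fun_eq_iff algebra_simps)

lift_definition times_lop :: "lop \<Rightarrow> lop \<Rightarrow> lop" is "\<lambda>f g x. f (g x)"
  by auto

instance
proof
  show "(0::lop) \<noteq> 1"
  proof transfer
    have "(\<lambda>x i. 0 :: complex) (\<lambda>i::nat. 1) 0 \<noteq> (\<lambda>x. x) (\<lambda>i::nat. 1) 0" by simp
    then show "(\<lambda>x i. 0 :: complex) \<noteq> (\<lambda>x::nat \<Rightarrow> complex. x)" by metis
  qed
qed (transfer; auto simp: fun_eq_iff)+

end

lemma lop_eqI: "(\<And>x i. app f x i = app g x i) \<Longrightarrow> f = g"
  by transfer (auto simp: fun_eq_iff)

lemma app_simps [simp]:
  "app 0 x = 0" "app 1 x = x" "app (f + g) x = app f x + app g x"
  "app (f * g) x = app f (app g x)"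
  by (transfer; auto simp: fun_eq_iff)+

lemma app_uminus [simp]: "app (- f) x i = - app f x i"
  by transfer auto

lemma app_minus [simp]: "app (f - g) x i = app f x i - app g x i"
  by transfer auto

lemma app_add_arg: "app f (x + y) = app f x + app f y"
  by transfer auto

lemma app_scale_arg: "app f (\<lambda>i. c * x i) = (\<lambda>i. c * app f x i)"
  by transfer auto

lemma app_zero_arg [simp]: "app f 0 = 0"
  using app_scale_arg[of f 0 0] by (auto simp: fun_eq_iff zero_fun_def)

lemma app_diff_arg: "app f (x - y) = app f x - app f y"
  using app_add_arg[of f "x - y" y] by (simp add: algebra_simps)

lemma app_sum: "app (sum f A) x = (\<Sum>a\<in>A. app (f a) x)"
  by (induction A rule: infinite_finite_induct) auto

lemma app_sum_arg: "app f (sum g A) = (\<Sum>a\<in>A. app f (g a))"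
  by (induction A rule: infinite_finite_induct)
    (simp_all only: sum.infinite sum.empty sum.insert app_zero_arg app_add_arg not_False_eq_True)

lemma sum_fun_apply: "sum f A i = (\<Sum>a\<in>A. f a i)"
  by (induction A rule: infinite_finite_induct) auto

lift_definition scal :: "complex \<Rightarrow> lop" is "\<lambda>c x i. c * x i"
  by (auto simp: fun_eq_iff algebra_simps)

lemma app_scal [simp]: "app (scal c) x i = c * x i"
  by transfer auto

lemma scal_central: "scal c * f = f * scal c"
proof (rule lop_eqI)
  fix x i
  have "app (scal c) x = (\<lambda>i. c * x i)" by (simp add: fun_eq_iff)
  then show "app (scal c * f) x i = app (f * scal c) x i"
    by (simp add: app_scale_arg)
qed

definition mop :: "complex mat \<Rightarrow> lop" where
  "mop A = Lop (\<lambda>x i. if i < dim_row A then \<Sum>k<dim_col A. A $$ (i, k) * x k else 0)"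

lemma app_mop: "app (mop A) x i = (if i < dim_row A then \<Sum>k<dim_col A. A $$ (i, k) * x k else 0)"
proof -
  have "(\<Sum>k<m. A $$ (i, k) * (u k + v k))
      = (\<Sum>k<m. A $$ (i, k) * u k) + (\<Sum>k<m. A $$ (i, k) * v k)" for u v m i
    unfolding distrib_left sum.distrib ..
  moreover have "(\<Sum>k<m. A $$ (i, k) * (c * u k)) = c * (\<Sum>k<m. A $$ (i, k) * u k)" for u m i c
    unfolding sum_distrib_left by (rule sum.cong) auto
  ultimately show ?thesis
    unfolding mop_def by (subst Lop_inverse) (simp_all add: fun_eq_iff)
qed

lemma mop_mult:
  assumes "dim_col A = dim_row B"
  shows "mop (A * B) = mop A * mop B"
proof (rule lop_eqI)
  fix x i
  show "app (mop (A * B)) x i = app (mop A * mop B) x i"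
  proof (cases "i < dim_row A")
    case True
    have "app (mop (A * B)) x i
        = (\<Sum>k<dim_col B. (\<Sum>l<dim_row B. A $$ (i, l) * B $$ (l, k)) * x k)"
      using True assms by (simp add: app_mop scalar_prod_def atLeast0LessThan)
    also have "\<dots> = (\<Sum>l<dim_row B. A $$ (i, l) * (\<Sum>k<dim_col B. B $$ (l, k) * x k))"
      unfolding sum_distrib_right sum_distrib_left
      by (subst sum.swap) (simp add: mult.assoc)
    finally show ?thesis using True assms by (simp add: app_mop)
  qed (simp add: app_mop)
qed

lemma mop_add:
  assumes "A \<in> carrier_mat n m" "B \<in> carrier_mat n m"
  shows "mop (A + B) = mop A + mop B"
  using assms by (intro lop_eqI) (auto simp: app_mop sum.distrib ring_distribs)

lemma mop_minus:
  assumes "A \<in> carrier_mat n m" "B \<in> carrier_mat n m"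
  shows "mop (A - B) = mop A - mop B"
  using assms by (intro lop_eqI) (auto simp: app_mop sum_subtractf left_diff_distrib)

lemma mop_uminus: "mop (- A) = - mop A"
  by (intro lop_eqI) (auto simp: app_mop sum_negf)

lemma mop_smult: "mop (c \<cdot>\<^sub>m A) = scal c * mop A"
  by (intro lop_eqI) (simp add: app_mop sum_distrib_left mult.assoc)

lemma mop_zero [simp]: "mop (0\<^sub>m n m) = 0"
  by (intro lop_eqI) (auto simp: app_mop)

lemma mop_sum:
  assumes "\<And>l. l \<in> I \<Longrightarrow> M l \<in> carrier_mat n m"
  shows "mop (mat n m (\<lambda>(a, b). \<Sum>l\<in>I. M l $$ (a, b))) = (\<Sum>l\<in>I. mop (M l))"
proof (rule lop_eqI)
  fix x i
  have "(\<Sum>k<m. (\<Sum>l\<in>I. M l $$ (i, k)) * x k) = (\<Sum>l\<in>I. \<Sum>k<m. M l $$ (i, k) * x k)"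
    by (simp add: sum_distrib_right sum.swap[of _ I])
  moreover have "\<And>l. l \<in> I \<Longrightarrow> dim_row (M l) = n" "\<And>l. l \<in> I \<Longrightarrow> dim_col (M l) = m"
    using assms by auto
  ultimately show "app (mop (mat n m (\<lambda>(a, b). \<Sum>l\<in>I. M l $$ (a, b)))) x i
      = app (\<Sum>l\<in>I. mop (M l)) x i"
    by (simp add: app_sum sum_fun_apply app_mop)
qed

abbreviation unit_fun :: "nat \<Rightarrow> nat \<Rightarrow> complex" where
  "unit_fun k \<equiv> (\<lambda>i. if i = k then 1 else 0)"

lemma app_mop_unit:
  "i < dim_row A \<Longrightarrow> k < dim_col A \<Longrightarrow> app (mop A) (unit_fun k) i = A $$ (i, k)"
  by (simp add: app_mop if_distrib[of "\<lambda>z. _ * z"] sum.delta cong: if_cong)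

lemma mop_inj:
  assumes "A \<in> carrier_mat n m" "B \<in> carrier_mat n m"
    and "\<And>x i. i < n \<Longrightarrow> app (mop A) x i = app (mop B) x i"
  shows "A = B"
proof (rule eq_matI)
  fix i j assume "i < dim_row B" "j < dim_col B"
  then show "A $$ (i, j) = B $$ (i, j)"
    using assms app_mop_unit[of i A j] app_mop_unit[of i B j] by auto
qed (use assms in auto)

lemma app_mop_cong:
  assumes "\<And>i. i < dim_col A \<Longrightarrow> x i = y i"
  shows "app (mop A) x = app (mop A) y"
  using assms by (auto simp: fun_eq_iff app_mop intro!: sum.cong)

section \<open>Inner products and adjoints\<close>

definition ip :: "nat \<Rightarrow> (nat \<Rightarrow> complex) \<Rightarrow> (nat \<Rightarrow> complex) \<Rightarrow> complex" where
  "ip n x y = (\<Sum>i<n. x i * cnj (y i))"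

lemma ip_add_left: "ip n (x + y) z = ip n x z + ip n y z"
  by (simp add: ip_def sum.distrib ring_distribs)

lemma ip_add_right: "ip n z (x + y) = ip n z x + ip n z y"
  by (simp add: ip_def sum.distrib ring_distribs)

lemma ip_diff_left: "ip n (x - y) z = ip n x z - ip n y z"
  by (simp add: ip_def sum_subtractf ring_distribs)

lemma ip_diff_right: "ip n z (x - y) = ip n z x - ip n z y"
  by (simp add: ip_def sum_subtractf ring_distribs)

lemma ip_scale_left: "ip n (\<lambda>i. c * x i) z = c * ip n x z"
  unfolding ip_def sum_distrib_left by (rule sum.cong) (auto simp: algebra_simps)

lemma ip_scale_right: "ip n z (\<lambda>i. c * x i) = cnj c * ip n z x"
  unfolding ip_def sum_distrib_left by (rule sum.cong) (auto simp: algebra_simps)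

lemma ip_zero [simp]: "ip n 0 z = 0" "ip n z 0 = 0"
  by (simp_all add: ip_def)

lemma ip_sum_left: "ip n (sum f A) z = (\<Sum>a\<in>A. ip n (f a) z)"
  by (induction A rule: infinite_finite_induct)
    (simp_all only: sum.infinite sum.empty sum.insert ip_zero ip_add_left not_False_eq_True)

lemma ip_sum_right: "ip n z (sum f A) = (\<Sum>a\<in>A. ip n z (f a))"
  by (induction A rule: infinite_finite_induct)
    (simp_all only: sum.infinite sum.empty sum.insert ip_zero ip_add_right not_False_eq_True)

lemma ip_commute: "ip n x y = cnj (ip n y x)"
  by (simp add: ip_def mult.commute)

lemma ip_cong: "(\<And>i. i < n \<Longrightarrow> x i = x' i) \<Longrightarrow> (\<And>i. i < n \<Longrightarrow> y i = y' i) \<Longrightarrow> ip n x y = ip n x' y'"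
  by (simp add: ip_def)

lemma ip_unit: "k < n \<Longrightarrow> ip n x (unit_fun k) = x k"
  by (simp add: ip_def if_distrib[of "\<lambda>z. _ * z"] if_distrib[of cnj] sum.delta cong: if_cong)

lemma ip_self_nonneg: "0 \<le> Re (ip n x x)"
  unfolding ip_def Re_sum by (rule sum_nonneg) simp

lemma ip_self_eq_0: "Re (ip n x x) = 0 \<Longrightarrow> i < n \<Longrightarrow> x i = 0"
proof -
  assume "Re (ip n x x) = 0" and i: "i < n"
  then have "(\<Sum>i<n. (Re (x i))\<^sup>2 + (Im (x i))\<^sup>2) = 0"
    by (simp add: ip_def power2_eq_square)
  then have "\<forall>i\<in>{..<n}. (Re (x i))\<^sup>2 + (Im (x i))\<^sup>2 = 0"
    by (subst (asm) sum_nonneg_eq_0_iff) auto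
  then show ?thesis using i by (simp add: complex_eq_iff)
qed

text \<open>
  As the inner products only see finitely many coordinates, an operator does not determine its
  adjoint; adjointness is therefore a relation between two operators.
\<close>

definition adj :: "nat \<Rightarrow> nat \<Rightarrow> lop \<Rightarrow> lop \<Rightarrow> bool" where
  "adj n m f g \<longleftrightarrow> (\<forall>x y. ip m (app f x) y = ip n x (app g y))"

lemma adjD: "adj n m f g \<Longrightarrow> ip m (app f x) y = ip n x (app g y)"
  by (simp add: adj_def)

lemma adj_sym: "adj n m f g \<Longrightarrow> adj m n g f"
  unfolding adj_def using ip_commute by metis

lemma adj_zero: "adj n m 0 0"
  by (simp add: adj_def)

lemma adj_one: "adj n n 1 1"
  by (simp add: adj_def)

lemma adj_add: "adj n m f g \<Longrightarrow> adj n m f' g' \<Longrightarrow> adj n m (f + f') (g + g')"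
  by (simp add: adj_def ip_add_left ip_add_right)

lemma adj_uminus: "adj n m f g \<Longrightarrow> adj n m (- f) (- g)"
proof -
  have *: "app (- h) x = (\<lambda>i. (-1) * app h x i)" for h x by (simp add: fun_eq_iff)
  assume "adj n m f g"
  then show ?thesis unfolding adj_def * ip_scale_left ip_scale_right by simp
qed

lemma adj_minus: "adj n m f g \<Longrightarrow> adj n m f' g' \<Longrightarrow> adj n m (f - f') (g - g')"
  using adj_add[OF _ adj_uminus, of n m f g f' g'] by simp

lemma adj_mult: "adj m r f g \<Longrightarrow> adj n m f' g' \<Longrightarrow> adj n r (f * f') (g' * g)"
  by (simp add: adj_def)

lemma adj_sum: "(\<And>a. a \<in> A \<Longrightarrow> adj n m (f a) (g a)) \<Longrightarrow> adj n m (sum f A) (sum g A)"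
  by (induction A rule: infinite_finite_induct) (auto simp: adj_zero adj_add)

lemma adj_scal_real: "adj n n (scal (complex_of_real c)) (scal (complex_of_real c))"
proof -
  have "app (scal d) x = (\<lambda>i. d * x i)" for d x by (simp add: fun_eq_iff)
  then show ?thesis by (simp add: adj_def ip_scale_left ip_scale_right)
qed

lemma mat_adjoint_dim [simp]:
  "dim_row (mat_adjoint A) = dim_col A" "dim_col (mat_adjoint A) = dim_row A"
  by (simp_all add: mat_adjoint_def)

lemma mat_adjoint_index [simp]:
  fixes A :: "complex mat"
  shows "i < dim_col A \<Longrightarrow> j < dim_row A \<Longrightarrow> mat_adjoint A $$ (i, j) = cnj (A $$ (j, i))"
  by (simp add: mat_adjoint_def mat_of_rows_def)

lemma mat_adjoint_mult:
  fixes A B :: "complex mat"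
  assumes "dim_col A = dim_row B"
  shows "mat_adjoint (A * B) = mat_adjoint B * mat_adjoint A"
  using assms by (intro eq_matI) (auto simp: scalar_prod_def mult.commute)

lemma mat_adjoint_adjoint [simp]: "mat_adjoint (mat_adjoint A) = (A :: complex mat)"
  by (intro eq_matI) auto

lemma adj_mop:
  assumes "A \<in> carrier_mat n m"
  shows "adj m n (mop A) (mop (mat_adjoint A))"
proof -
  have "(\<Sum>i<n. (\<Sum>k<m. A $$ (i, k) * x k) * cnj (y i))
      = (\<Sum>k<m. x k * cnj (\<Sum>i<n. cnj (A $$ (i, k)) * y i))" for x y
    unfolding sum_distrib_left sum_distrib_right cnj_sum
    by (subst sum.swap) (intro sum.cong, auto)
  then show ?thesis using assms by (auto simp: adj_def ip_def app_mop)
qed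

abbreviation selfadj :: "nat \<Rightarrow> lop \<Rightarrow> bool" where
  "selfadj n f \<equiv> adj n n f f"

lemma selfadj_mop:
  assumes "A \<in> carrier_mat n n" "mat_adjoint A = A"
  shows "selfadj n (mop A)"
  using adj_mop[OF assms(1)] assms(2) by simp

lemma mat_adjoint_eq_self:
  assumes A: "A \<in> carrier_mat n n" and "selfadj n (mop A)"
  shows "mat_adjoint A = A"
proof (rule eq_matI)
  fix i j assume "i < dim_row A" "j < dim_col A"
  then have ij: "i < n" "j < n" using A by auto
  have "cnj (A $$ (j, i)) = cnj (ip n (app (mop A) (unit_fun i)) (unit_fun j))"
    using ij A by (simp add: ip_unit app_mop_unit)
  also have "\<dots> = cnj (ip n (unit_fun i) (app (mop A) (unit_fun j)))"
    by (simp only: adjD[OF assms(2)])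
  also have "\<dots> = ip n (app (mop A) (unit_fun j)) (unit_fun i)"
    by (rule ip_commute[symmetric])
  also have "\<dots> = A $$ (i, j)"
    using ij A by (simp add: ip_unit app_mop_unit)
  finally show "mat_adjoint A $$ (i, j) = A $$ (i, j)" using ij A by simp
qed (use A in auto)

lemma ip_scalar_prod:
  assumes "A \<in> carrier_mat n n"
  shows "(A *\<^sub>v vec n x) \<bullet>c vec n x = ip n (app (mop A) x) x"
  using assms by (auto simp: ip_def app_mop scalar_prod_def atLeast0LessThan intro!: sum.cong)

lemma nonneg_hermitian_iff:
  "nonneg_hermitian n A \<longleftrightarrow> A \<in> carrier_mat n n \<and> selfadj n (mop A) \<and>
     (\<forall>x. 0 \<le> Re (ip n (app (mop A) x) x))"
proof -
  have "(\<forall>v \<in> carrier_vec n. 0 \<le> Re ((A *\<^sub>v v) \<bullet>c v)) \<longleftrightarrow> (\<forall>x. 0 \<le> Re (ip n (app (mop A) x) x))"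
    if A: "A \<in> carrier_mat n n"
  proof safe
    fix v :: "complex vec" assume v: "v \<in> carrier_vec n" and "\<forall>x. 0 \<le> Re (ip n (app (mop A) x) x)"
    then show "0 \<le> Re ((A *\<^sub>v v) \<bullet>c v)"
      using ip_scalar_prod[OF A, of "\<lambda>i. v $ i"] by (metis carrier_vecD eq_vecI dim_vec index_vec)
  qed (use ip_scalar_prod[OF A, symmetric] in simp)
  then show ?thesis
    unfolding nonneg_hermitian_def using selfadj_mop mat_adjoint_eq_self by blast
qed

lemma pos_hermitian_iff:
  "pos_hermitian n A \<longleftrightarrow> A \<in> carrier_mat n n \<and> selfadj n (mop A) \<and>
     (\<forall>x. (\<exists>i<n. x i \<noteq> 0) \<longrightarrow> 0 < Re (ip n (app (mop A) x) x))"
proof -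
  have "(\<forall>v \<in> carrier_vec n. v \<noteq> 0\<^sub>v n \<longrightarrow> 0 < Re ((A *\<^sub>v v) \<bullet>c v)) \<longleftrightarrow>
      (\<forall>x. (\<exists>i<n. x i \<noteq> 0) \<longrightarrow> 0 < Re (ip n (app (mop A) x) x))"
    if A: "A \<in> carrier_mat n n"
  proof safe
    fix v :: "complex vec"
    assume v: "v \<in> carrier_vec n" "v \<noteq> 0\<^sub>v n"
      and *: "\<forall>x. (\<exists>i<n. x i \<noteq> 0) \<longrightarrow> 0 < Re (ip n (app (mop A) x) x)"
    have "\<exists>i<n. v $ i \<noteq> 0" using v by (metis carrier_vecD eq_vecI index_zero_vec)
    moreover have "vec n (\<lambda>i. v $ i) = v" using v by auto
    ultimately show "0 < Re ((A *\<^sub>v v) \<bullet>c v)"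
      using ip_scalar_prod[OF A, of "\<lambda>i. v $ i"] * by simp
  next
    fix x :: "nat \<Rightarrow> complex" and i
    assume *: "\<forall>v \<in> carrier_vec n. v \<noteq> 0\<^sub>v n \<longrightarrow> 0 < Re ((A *\<^sub>v v) \<bullet>c v)" and i: "i < n" "x i \<noteq> 0"
    have "vec n x \<noteq> 0\<^sub>v n" using i by (metis index_vec index_zero_vec(1))
    then show "0 < Re (ip n (app (mop A) x) x)"
      using * ip_scalar_prod[OF A, of x] by (metis vec_carrier)
  qed
  then show ?thesis
    unfolding pos_hermitian_def using selfadj_mop mat_adjoint_eq_self by blast
qed

text \<open>
  Replacing \<open>x\<close> by \<open>x - \<tau> A x\<close> with a small \<open>\<tau> > 0\<close> changes the form by
  \<open>- 2 \<tau> \<parallel>A x\<parallel>\<^sup>2\<close> to first order, so it would become negative unless \<open>A x = 0\<close>.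
\<close>

lemma nonneg_form_kernel:
  assumes "nonneg_hermitian n A" "Re (ip n (app (mop A) x) x) = 0" "i < n"
  shows "app (mop A) x i = 0"
proof -
  let ?f = "mop A" let ?y = "app ?f x"
  have A: "selfadj n ?f" "\<And>x. 0 \<le> Re (ip n (app ?f x) x)"
    using assms(1) by (auto simp: nonneg_hermitian_iff)
  define N where "N = Re (ip n ?y ?y)"
  define C where "C = Re (ip n (app ?f ?y) ?y)"
  have ineq: "2 * N \<le> \<tau> * C" if "\<tau> > 0" for \<tau> :: real
  proof -
    let ?z = "\<lambda>i. complex_of_real \<tau> * ?y i"
    have "ip n (app ?f (x - ?z)) (x - ?z)
        = ip n ?y x - ip n ?y ?z - ip n (app ?f ?z) x + ip n (app ?f ?z) ?z"
      by (simp add: app_diff_arg ip_diff_left ip_diff_right)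
    moreover have "ip n ?y ?z = \<tau> * ip n ?y ?y" by (simp add: ip_scale_right)
    moreover have "ip n (app ?f ?z) x = \<tau> * ip n ?y ?y"
      by (simp add: app_scale_arg ip_scale_left adjD[OF A(1)])
    moreover have "ip n (app ?f ?z) ?z = \<tau> * \<tau> * ip n (app ?f ?y) ?y"
      by (simp add: app_scale_arg ip_scale_left ip_scale_right)
    ultimately have "0 \<le> - 2 * \<tau> * N + \<tau> * \<tau> * C"
      using A(2)[of "x - ?z"] assms(2) by (simp add: N_def C_def)
    then have "0 \<le> \<tau> * (\<tau> * C - 2 * N)" by (simp add: algebra_simps)
    then show ?thesis using that by (simp add: zero_le_mult_iff)
  qed
  have "N \<le> 0"
  proof (rule ccontr)
    assume "\<not> N \<le> 0"
    \<comment> \<open>Small enough for the linear term to dominate the quadratic one.\<close>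
    define \<tau> where "\<tau> = N / (\<bar>C\<bar> + 1)"
    have "\<tau> > 0" using \<open>\<not> N \<le> 0\<close> by (simp add: \<tau>_def)
    moreover have "\<tau> * C \<le> N"
    proof -
      have "\<tau> * C \<le> \<tau> * (\<bar>C\<bar> + 1)" using \<open>\<tau> > 0\<close> by (intro mult_left_mono) auto
      then show ?thesis by (simp add: \<tau>_def)
    qed
    ultimately show False using ineq[of \<tau>] \<open>\<not> N \<le> 0\<close> by simp
  qed
  then have "N = 0" using ip_self_nonneg[of n ?y] by (simp add: N_def)
  then show ?thesis using ip_self_eq_0 assms(3) by (simp add: N_def)
qed

section \<open>The Moore--Penrose inverse of a Hermitian matrix\<close>

text \<open>
  Powers of \<open>A\<close> can be cancelled one at a time, because \<open>A (A u) = 0\<close> makes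
  \<open>\<parallel>A u\<parallel>\<^sup>2 = \<langle>A (A u), u\<rangle>\<close> vanish.
\<close>

lemma selfadj_power_kernel:
  assumes "A \<in> carrier_mat n n" "selfadj n (mop A)"
    and "\<And>i. i < n \<Longrightarrow> app (mop A ^ r) z i = 0"
  shows "i < n \<Longrightarrow> app (mop A) z i = 0"
  using assms(3)
proof (induction r arbitrary: i rule: nat_induct)
  case 0
  then have "app (mop A) z = app (mop A) 0"
    using assms(1) by (intro app_mop_cong) auto
  then show ?case by simp
next
  case (Suc r)
  show ?case
  proof (cases r)
    case 0
    then show ?thesis using Suc.prems by simp
  next
    case (Suc r')
    define u where "u = app (mop A ^ r') z"
    have "app (mop A) (app (mop A) u) i = 0" if "i < n" for i
      using Suc.prems(2)[OF that] \<open>r = Suc r'\<close> by (simp add: u_def)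
    then have "ip n (app (mop A) (app (mop A) u)) u = 0"
      by (simp add: ip_def)
    then have "Re (ip n (app (mop A) u) (app (mop A) u)) = 0"
      by (simp add: adjD[OF assms(2)])
    then have "app (mop A ^ r) z i = 0" if "i < n" for i
      using ip_self_eq_0[OF _ that] \<open>r = Suc r'\<close> by (simp add: u_def)
    then show ?thesis using Suc.IH Suc.prems(1) by blast
  qed
qed

text \<open>
  The \<open>n + 1\<close> vectors \<open>e, A e, \<dots>, A\<^sup>n e\<close> in an \<open>n\<close>-dimensional space are linearly dependent.
  Cancelling the lowest power of \<open>A\<close> that occurs in a dependency writes \<open>e\<close> as
  an element of the range plus an element of the kernel of \<open>A\<close>.
\<close>

lemma selfadj_range_kernel_decomposition:
  fixes e :: "nat \<Rightarrow> complex"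
  assumes A: "A \<in> carrier_mat n n" "selfadj n (mop A)"
  shows "\<exists>y. \<forall>i<n. app (mop A) (app (mop A) y) i = app (mop A) e i"
proof -
  define w where "w i = app (mop A ^ i) e" for i
  \<comment> \<open>A row of zeros makes the matrix square and singular; its kernel is the set of dependencies.\<close>
  define M where "M = mat (Suc n) (Suc n) (\<lambda>(a, i). if a < n then w i a else 0)"
  have M: "M \<in> carrier_mat (Suc n) (Suc n)" by (simp add: M_def)
  have "transpose_mat M *\<^sub>v unit_vec (Suc n) n = 0\<^sub>v (Suc n)"
    by (intro eq_vecI) (auto simp: M_def)
  then have "det (transpose_mat M) = 0"
    using det_0_iff_vec_prod_zero_field[of "transpose_mat M" "Suc n"] M
    by (metis lessI transpose_carrier_mat unit_vec_carrier unit_vec_nonzero)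
  then have "det M = 0" using det_transpose[OF M] by simp
  then obtain v where v: "v \<in> carrier_vec (Suc n)" "v \<noteq> 0\<^sub>v (Suc n)" "M *\<^sub>v v = 0\<^sub>v (Suc n)"
    using det_0_iff_vec_prod_zero_field[OF M] by blast
  have dep: "(\<Sum>i\<le>n. v $ i * w i a) = 0" if "a < n" for a
  proof -
    have "(M *\<^sub>v v) $ a = (\<Sum>i\<le>n. v $ i * w i a)"
      using that v(1) by (auto simp: M_def scalar_prod_def atLeast0LessThan lessThan_Suc_atMost
        intro!: sum.cong)
    then show ?thesis using v(3) that by simp
  qed
  have ex: "\<exists>i\<le>n. v $ i \<noteq> 0"
    using v(1,2) by (metis carrier_vecD eq_vecI index_zero_vec less_Suc_eq_le)
  define r where "r = (LEAST i. v $ i \<noteq> 0)"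
  have r: "v $ r \<noteq> 0" "r \<le> n" and below: "\<And>i. i < r \<Longrightarrow> v $ i = 0"
    using ex unfolding r_def
    by (metis (mono_tags, lifting) LeastI, meson Least_le le_trans, use not_less_Least in blast)
  define f where "f = (\<Sum>i\<in>{Suc r..n}. (\<lambda>a. v $ i * w (i - Suc r) a))"
  define z where "z = (\<lambda>a. v $ r * e a) + app (mop A) f"
  have wpow: "app (mop A ^ j) (w i) = w (i + j)" for i j
    by (simp add: w_def power_add[symmetric] add.commute flip: app_simps(4))
  have "app (mop A) f = (\<Sum>i\<in>{Suc r..n}. (\<lambda>a. v $ i * w (i - r) a))"
    unfolding f_def app_sum_arg app_scale_arg
    using wpow[of 1] by (intro sum.cong) (auto simp: Suc_diff_Suc)
  then have z: "z = (\<Sum>i\<in>{r..n}. (\<lambda>a. v $ i * w (i - r) a))"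
    using r(2) by (simp add: z_def sum.atLeast_Suc_atMost w_def)
  have "app (mop A ^ r) z a = 0" if "a < n" for a
  proof -
    have "app (mop A ^ r) z a = (\<Sum>i\<in>{r..n}. v $ i * w i a)"
      unfolding z app_sum_arg app_scale_arg sum_fun_apply
      using wpow by (intro sum.cong) auto
    also have "\<dots> = (\<Sum>i\<le>n. v $ i * w i a)"
      using below by (intro sum.mono_neutral_left) auto
    finally show ?thesis using dep that by simp
  qed
  then have *: "app (mop A) z i = 0" if "i < n" for i
    using selfadj_power_kernel[OF A, of r z] that by blast
  have "app (mop A) (app (mop A) (\<lambda>a. (- 1 / v $ r) * f a)) i = app (mop A) e i" if "i < n" for i
    using *[OF that] r(1)
    by (simp only: z_def app_scale_arg app_add_arg plus_fun_apply)
      (simp add: field_simps add_eq_0_iff)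
  then show ?thesis by blast
qed

text \<open>
  Solving \<open>A\<^sup>2 Y = A\<close> columnwise; the Moore--Penrose inverse is then \<open>Y\<^sup>* A Y\<close>.
\<close>

lemma hermitian_square_factor:
  assumes A: "A \<in> carrier_mat n n" "selfadj n (mop A)"
  shows "\<exists>Y \<in> carrier_mat n n. A * (A * Y) = A"
proof -
  obtain y where y: "\<And>e i. i < n \<Longrightarrow> app (mop A) (app (mop A) (y e)) i = app (mop A) e i"
    using selfadj_range_kernel_decomposition[OF A] by metis
  define Y where "Y = mat n n (\<lambda>(i, k). y (unit_fun k) i)"
  have Y: "Y \<in> carrier_mat n n" by (simp add: Y_def)
  have "A * (A * Y) = A"
  proof (rule eq_matI)
    fix i k assume "i < dim_row A" "k < dim_col A"
    then have ik: "i < n" "k < n" using A by auto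
    have "app (mop A) (app (mop Y) (unit_fun k)) = app (mop A) (y (unit_fun k))"
      using A Y ik by (intro app_mop_cong) (simp add: app_mop_unit, simp add: Y_def)
    then have "app (mop (A * (A * Y))) (unit_fun k) i = app (mop A) (unit_fun k) i"
      using A Y ik y by (simp add: mop_mult)
    then show "(A * (A * Y)) $$ (i, k) = A $$ (i, k)"
      using A Y ik app_mop_unit[of i "A * (A * Y)" k] app_mop_unit[of i A k] by simp
  qed (use A Y in auto)
  then show ?thesis using Y by blast
qed

definition penrose :: "nat \<Rightarrow> complex mat \<Rightarrow> complex mat \<Rightarrow> bool" where
  "penrose n A X \<longleftrightarrow> X \<in> carrier_mat n n \<and> A * X * A = A \<and> X * A * X = X \<and>
     mat_adjoint (A * X) = A * X \<and> mat_adjoint (X * A) = X * A"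

lemma penrose_unique:
  assumes A: "A \<in> carrier_mat n n" and "penrose n A X" "penrose n A Y"
  shows "X = Y"
proof -
  have X: "X \<in> carrier_mat n n" "A * X * A = A" "X * A * X = X"
      "mat_adjoint (A * X) = A * X" "mat_adjoint (X * A) = X * A"
    and Y: "Y \<in> carrier_mat n n" "A * Y * A = A" "Y * A * Y = Y"
      "mat_adjoint (A * Y) = A * Y" "mat_adjoint (Y * A) = Y * A"
    using assms by (auto simp: penrose_def)
  note assoc = assoc_mult_mat[of _ n n _ n _ n]
  note car = A X(1) Y(1) mult_carrier_mat[of _ n n _ n]
  have "A * X = (A * Y) * (A * X)"
  proof -
    have "(A * Y) * (A * X) = (A * Y * A) * X" using car by (simp add: assoc)
    then show ?thesis using Y(2) by simp
  qed
  then have "A * X = mat_adjoint ((A * Y) * (A * X))" using X(4) by metis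
  also have "\<dots> = (A * X) * (A * Y)" using X(4) Y(4) car by (subst mat_adjoint_mult) auto
  also have "\<dots> = A * X * A * Y" using car by (simp add: assoc)
  also have "\<dots> = A * Y" using X(2) by simp
  finally have AX: "A * X = A * Y" .
  have "X * A = (X * A) * (Y * A)"
  proof -
    have "(X * A) * (Y * A) = X * (A * Y * A)" using car by (simp add: assoc)
    then show ?thesis using Y(2) by simp
  qed
  then have "X * A = mat_adjoint ((X * A) * (Y * A))" using X(5) by metis
  also have "\<dots> = (Y * A) * (X * A)" using X(5) Y(5) car by (subst mat_adjoint_mult) auto
  also have "\<dots> = Y * (A * X * A)" using car by (simp add: assoc)
  also have "\<dots> = Y * A" using X(2) by simp
  finally have XA: "X * A = Y * A" .
  have "X = (X * A) * X" using X(3) by simp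
  also have "\<dots> = Y * (A * X)" using XA car by (simp add: assoc)
  also have "\<dots> = (Y * A) * Y" using AX car by (simp add: assoc)
  finally show ?thesis using Y(3) by simp
qed

text \<open>
  If \<open>A\<^sup>2 Y = A\<close>, then \<open>E = A Y\<close> satisfies \<open>E\<^sup>* E = Y\<^sup>* A\<^sup>2 Y = Y\<^sup>* A = E\<^sup>*\<close>.
  Hence \<open>E\<close> is Hermitian, and it is both \<open>A X\<close> and \<open>X A\<close> for \<open>X = Y\<^sup>* A Y\<close>.
\<close>

lemma penrose_exists:
  assumes A: "A \<in> carrier_mat n n" "mat_adjoint A = A"
  shows "\<exists>X. penrose n A X"
proof -
  obtain Y where Y: "Y \<in> carrier_mat n n" and f1: "A * (A * Y) = A"
    using hermitian_square_factor[OF A(1) selfadj_mop[OF A]] by blast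
  define B where "B = mat_adjoint Y"
  have B: "B \<in> carrier_mat n n" using Y unfolding B_def carrier_mat_def by simp
  note assoc = assoc_mult_mat[of _ n n _ n _ n]
  note car = A(1) B Y mult_carrier_mat[of _ n n _ n]
  have adjAY: "mat_adjoint (A * Y) = B * A" using car A by (simp add: mat_adjoint_mult B_def)
  have f2: "B * A * A = A"
    using arg_cong[OF f1, of mat_adjoint] car A adjAY by (simp add: mat_adjoint_mult)
  have sq: "(B * A) * (A * Y) = B * A" using f1 car by (simp add: assoc)
  have "mat_adjoint ((B * A) * (A * Y)) = (B * A) * (A * Y)"
    using car adjAY[symmetric] by (simp add: mat_adjoint_mult)
  then have "mat_adjoint (B * A) = B * A" using sq by simp
  then have f3: "A * Y = B * A" using adjAY by (metis mat_adjoint_adjoint)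
  define X where "X = B * (A * Y)"
  have X: "X \<in> carrier_mat n n" unfolding X_def using car by simp
  have "A * X = A * (B * A) * Y" unfolding X_def using car by (simp add: assoc)
  also have "\<dots> = A * (A * Y) * Y" by (simp add: f3)
  finally have AX: "A * X = A * Y" by (simp add: f1)
  have "X * A = B * ((A * Y) * A)" unfolding X_def using car by (simp add: assoc)
  also have "\<dots> = B * (B * A * A)" by (simp add: f3)
  finally have XA: "X * A = B * A" by (simp add: f2)
  have "A * X * A = A" using f2 f3 by (simp add: AX)
  moreover have "X * A * X = X"
  proof -
    have "X * A * X = B * A * X" by (simp only: XA)
    also have "\<dots> = B * (A * X)" using X car by (intro assoc) auto
    also have "\<dots> = B * (A * Y)" by (simp only: AX)
    also have "\<dots> = X" by (simp only: X_def)
    finally show ?thesis .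
  qed
  moreover have "mat_adjoint (A * X) = A * X" "mat_adjoint (X * A) = X * A"
    using AX XA adjAY f3 by auto
  ultimately show ?thesis using X unfolding penrose_def by blast
qed

text \<open>
  For Hermitian \<open>A\<close> the adjoint \<open>X\<^sup>*\<close> solves the same four equations as \<open>X\<close>, so
  uniqueness gives \<open>X\<^sup>* = X\<close>, and then \<open>A X = (A X)\<^sup>* = X A\<close>.
\<close>

lemma mp_inverse_hermitian:
  assumes A: "A \<in> carrier_mat n n" "mat_adjoint A = A"
  shows "mp_inverse A \<in> carrier_mat n n" "A * mp_inverse A * A = A"
    "mp_inverse A * A * mp_inverse A = mp_inverse A" "mat_adjoint (mp_inverse A) = mp_inverse A"
    "mp_inverse A * A = A * mp_inverse A" "mat_adjoint (A * mp_inverse A) = A * mp_inverse A"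
proof -
  have "\<exists>!X. penrose n A X" using penrose_exists[OF A] penrose_unique[OF A(1)] by blast
  moreover have "mp_inverse A = (THE X. penrose n A X)"
    using A(1) unfolding mp_inverse_def penrose_def by auto
  ultimately have "penrose n A (mp_inverse A)" by (metis theI')
  then have X: "mp_inverse A \<in> carrier_mat n n" and X1: "A * mp_inverse A * A = A"
    "mp_inverse A * A * mp_inverse A = mp_inverse A" "mat_adjoint (A * mp_inverse A) = A * mp_inverse A"
    and X2: "mat_adjoint (mp_inverse A * A) = mp_inverse A * A"
    unfolding penrose_def by auto
  show "mp_inverse A \<in> carrier_mat n n" "A * mp_inverse A * A = A"
    "mp_inverse A * A * mp_inverse A = mp_inverse A" "mat_adjoint (A * mp_inverse A) = A * mp_inverse A"
    by (fact X X1)+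
  define B where "B = mat_adjoint (mp_inverse A)"
  have B: "B \<in> carrier_mat n n" using X unfolding B_def carrier_mat_def by simp
  have adj1: "mat_adjoint (A * mp_inverse A) = B * A" "mat_adjoint (mp_inverse A * A) = A * B"
    using A X by (simp_all add: mat_adjoint_mult B_def)
  note assoc = assoc_mult_mat[of _ n n _ n _ n]
  note car = A(1) B X mult_carrier_mat[of _ n n _ n]
  have "A * B * A = A"
    using arg_cong[OF X1(1), of mat_adjoint] car A(2) adj1 by (simp add: mat_adjoint_mult assoc)
  moreover have "B * A * B = B"
    using arg_cong[OF X1(2), of mat_adjoint] car A(2) adj1
    by (simp add: mat_adjoint_mult B_def[symmetric] assoc)
  ultimately have "penrose n A B"
    using B X1(3) X2 adj1 unfolding penrose_def by metis
  then show "mat_adjoint (mp_inverse A) = mp_inverse A"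
    using penrose_unique[OF A(1)] \<open>penrose n A (mp_inverse A)\<close> unfolding B_def by metis
  then show "mp_inverse A * A = A * mp_inverse A" using adj1 X1(3) unfolding B_def by metis
qed

section \<open>Quadratic forms of block kernels\<close>

definition form :: "nat \<Rightarrow> (nat \<Rightarrow> nat \<Rightarrow> lop) \<Rightarrow> nat \<Rightarrow> (nat \<Rightarrow> nat \<Rightarrow> complex) \<Rightarrow> complex" where
  "form q M n x = (\<Sum>j\<le>n. \<Sum>k\<le>n. ip q (app (M j k) (x k)) (x j))"

definition psd :: "nat \<Rightarrow> (nat \<Rightarrow> nat \<Rightarrow> lop) \<Rightarrow> nat \<Rightarrow> bool" where
  "psd q M n \<longleftrightarrow> (\<forall>x. 0 \<le> Re (form q M n x))"

definition pd :: "nat \<Rightarrow> (nat \<Rightarrow> nat \<Rightarrow> lop) \<Rightarrow> nat \<Rightarrow> bool" where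
  "pd q M n \<longleftrightarrow> (\<forall>x. (\<exists>j\<le>n. \<exists>i<q. x j i \<noteq> 0) \<longrightarrow> 0 < Re (form q M n x))"

text \<open>
  Every last component can be completed to a vector on which the form vanishes. For nonnegative
  block Hankel matrices this expresses that the Schur complement \<open>L\<^sub>n\<close> is zero; unlike \<open>L\<^sub>n\<close>
  itself, it is visibly preserved by triangular substitutions that fix the last component.
\<close>

definition degenerate :: "nat \<Rightarrow> (nat \<Rightarrow> nat \<Rightarrow> lop) \<Rightarrow> nat \<Rightarrow> bool" where
  "degenerate q M n \<longleftrightarrow> (\<forall>z. \<exists>x. x n = z \<and> Re (form q M n x) = 0)"

lemma form_cong:
  "(\<And>j k. j \<le> n \<Longrightarrow> k \<le> n \<Longrightarrow> M j k = N j k) \<Longrightarrow> form q M n x = form q N n x"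
  by (simp add: form_def)

definition flat :: "nat \<Rightarrow> (nat \<Rightarrow> nat \<Rightarrow> complex) \<Rightarrow> nat \<Rightarrow> complex" where
  "flat q x = (\<lambda>i. x (i div q) (i mod q))"

lemma flat_index: "i < q \<Longrightarrow> flat q x (j * q + i) = x j i"
  by (simp add: flat_def)

lemma flat_surj:
  assumes "1 \<le> q"
  shows "\<exists>x. flat q x = y"
proof
  show "flat q (\<lambda>j i. y (j * q + i)) = y"
    by (simp add: flat_def fun_eq_iff)
qed

lemma all_flat: "1 \<le> q \<Longrightarrow> (\<forall>y. P y) \<longleftrightarrow> (\<forall>x. P (flat q x))"
  using flat_surj by metis

lemma sum_blocks:
  fixes f :: "nat \<Rightarrow> complex"
  shows "(\<Sum>i<m * q. f i) = (\<Sum>j<m. \<Sum>i<q. f (j * q + i))"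
proof -
  have "sum f {j * q..<j * q + q} = (\<Sum>i<q. f (j * q + i))" for j
    using sum.shift_bounds_nat_ivl[of f 0 "j * q" q]
    by (simp add: add.commute atLeast0LessThan)
  then show ?thesis by (simp flip: sum.nat_group)
qed

lemma block_index_less: "j < m \<Longrightarrow> i < q \<Longrightarrow> j * q + i < m * (q :: nat)"
proof -
  assume "j < m" "i < q"
  then have "j * q + i < Suc j * q" by simp
  also have "\<dots> \<le> m * q" using \<open>j < m\<close> by (intro mult_le_mono1) simp
  finally show ?thesis .
qed

lemma block_mat_carrier [simp]: "block_mat q m n B \<in> carrier_mat (m * q) (n * q)"
  by (simp add: block_mat_def)

lemma app_block_mat:
  assumes "j < m" "i < q" "\<And>k. k < n \<Longrightarrow> B j k \<in> carrier_mat q q"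
  shows "app (mop (block_mat q m n B)) (flat q x) (j * q + i)
      = (\<Sum>k<n. app (mop (B j k)) (x k)) i"
proof -
  have "app (mop (block_mat q m n B)) (flat q x) (j * q + i)
      = (\<Sum>l<n * q. block_mat q m n B $$ (j * q + i, l) * flat q x l)"
    using block_index_less[OF assms(1,2)] by (simp add: app_mop block_mat_def)
  also have "\<dots> = (\<Sum>k<n. \<Sum>l<q. B j k $$ (i, l) * x k l)"
    unfolding sum_blocks
    using block_index_less[OF assms(1,2)] assms(2)
    by (intro sum.cong refl) (simp add: block_mat_def flat_index block_index_less)
  also have "\<dots> = (\<Sum>k<n. app (mop (B j k)) (x k) i)"
    using assms(2,3) by (intro sum.cong refl) (auto simp: app_mop)
  finally show ?thesis by (simp only: sum_fun_apply)
qed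

lemma ip_block_mat:
  assumes "\<And>j k. j < m \<Longrightarrow> k < n \<Longrightarrow> B j k \<in> carrier_mat q q"
  shows "ip (m * q) (app (mop (block_mat q m n B)) (flat q x)) (flat q y)
      = (\<Sum>j<m. \<Sum>k<n. ip q (app (mop (B j k)) (x k)) (y j))"
proof -
  have "ip (m * q) (app (mop (block_mat q m n B)) (flat q x)) (flat q y)
      = (\<Sum>j<m. \<Sum>i<q. (\<Sum>k<n. app (mop (B j k)) (x k)) i * cnj (y j i))"
    unfolding ip_def sum_blocks
    using assms by (intro sum.cong refl) (simp only: lessThan_iff app_block_mat flat_index)
  also have "\<dots> = (\<Sum>j<m. ip q (\<Sum>k<n. app (mop (B j k)) (x k)) (y j))"
    by (simp only: ip_def)
  finally show ?thesis by (simp only: ip_sum_left)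
qed

abbreviation hankel_kernel :: "(nat \<Rightarrow> complex mat) \<Rightarrow> nat \<Rightarrow> nat \<Rightarrow> lop" where
  "hankel_kernel s \<equiv> (\<lambda>j k. mop (s (j + k)))"

lemma ip_hankel:
  assumes "\<And>j. j \<le> 2 * n \<Longrightarrow> s j \<in> carrier_mat q q"
  shows "ip (Suc n * q) (app (mop (hankel q s n)) (flat q x)) (flat q x)
      = form q (hankel_kernel s) n x"
  unfolding hankel_def using assms
  by (subst ip_block_mat) (auto simp: form_def lessThan_Suc_atMost)

lemma mat_adjoint_hankel:
  assumes "1 \<le> q" "\<And>j. j \<le> 2 * n \<Longrightarrow> s j \<in> carrier_mat q q"
  shows "mat_adjoint (hankel q s n) = hankel q s n \<longleftrightarrow> (\<forall>j\<le>2 * n. mat_adjoint (s j) = s j)"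
proof
  assume *: "mat_adjoint (hankel q s n) = hankel q s n"
  show "\<forall>j\<le>2 * n. mat_adjoint (s j) = s j"
  proof (intro allI impI)
    fix j assume j: "j \<le> 2 * n"
    define a b where "a = min j n" and "b = j - min j n"
    then have ab: "j = a + b" "a < Suc n" "b < Suc n" using j by auto
    show "mat_adjoint (s j) = s j"
    proof (rule eq_matI)
      fix i l assume "i < dim_row (s j)" "l < dim_col (s j)"
      then have il: "i < q" "l < q" using assms(2)[OF j] by auto
      have "mat_adjoint (hankel q s n) $$ (a * q + i, b * q + l) = hankel q s n $$ (a * q + i, b * q + l)"
        using * by simp
      then show "mat_adjoint (s j) $$ (i, l) = s j $$ (i, l)"
        using il ab assms(2)[OF j] block_index_less[OF ab(2) il(1)] block_index_less[OF ab(3) il(2)]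
        by (simp add: hankel_def block_mat_def add.commute)
    qed (use assms(2)[OF j] in auto)
  qed
next
  assume *: "\<forall>j\<le>2 * n. mat_adjoint (s j) = s j"
  show "mat_adjoint (hankel q s n) = hankel q s n"
  proof (rule eq_matI)
    fix a b assume "a < dim_row (hankel q s n)" "b < dim_col (hankel q s n)"
    then have ab: "a < Suc n * q" "b < Suc n * q" by (simp_all add: hankel_def block_mat_def)
    then have d: "a div q < Suc n" "b div q < Suc n" "a mod q < q" "b mod q < q"
      using assms(1) by (auto simp: less_mult_imp_div_less)
    then have le: "a div q + b div q \<le> 2 * n" by simp
    have "cnj (s (a div q + b div q) $$ (b mod q, a mod q))
        = mat_adjoint (s (a div q + b div q)) $$ (a mod q, b mod q)"
      using assms(2)[OF le] d by simp
    also have "\<dots> = s (a div q + b div q) $$ (a mod q, b mod q)" using * le by simp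
    finally show "mat_adjoint (hankel q s n) $$ (a, b) = hankel q s n $$ (a, b)"
      using ab by (simp add: hankel_def block_mat_def add.commute)
  qed (simp_all add: hankel_def block_mat_def)
qed

lemma selfadj_hankel:
  assumes "1 \<le> q" "\<And>j. j \<le> 2 * n \<Longrightarrow> s j \<in> carrier_mat q q"
  shows "selfadj (Suc n * q) (mop (hankel q s n)) \<longleftrightarrow> (\<forall>j\<le>2 * n. selfadj q (mop (s j)))"
proof -
  have "hankel q s n \<in> carrier_mat (Suc n * q) (Suc n * q)" by (simp only: hankel_def block_mat_carrier)
  then have "selfadj (Suc n * q) (mop (hankel q s n)) \<longleftrightarrow> mat_adjoint (hankel q s n) = hankel q s n"
    using selfadj_mop mat_adjoint_eq_self by blast
  moreover have "selfadj q (mop (s j)) \<longleftrightarrow> mat_adjoint (s j) = s j" if "j \<le> 2 * n" for j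
    using assms(2)[OF that] selfadj_mop mat_adjoint_eq_self by blast
  ultimately show ?thesis using mat_adjoint_hankel[of q n s, OF assms] by simp
qed

lemma nonneg_hermitian_hankel:
  assumes "1 \<le> q" "\<And>j. j \<le> 2 * n \<Longrightarrow> s j \<in> carrier_mat q q"
  shows "nonneg_hermitian (Suc n * q) (hankel q s n) \<longleftrightarrow>
    (\<forall>j\<le>2 * n. selfadj q (mop (s j))) \<and> psd q (hankel_kernel s) n"
proof -
  have "hankel q s n \<in> carrier_mat (Suc n * q) (Suc n * q)" by (simp only: hankel_def block_mat_carrier)
  moreover have "(\<forall>x. 0 \<le> Re (ip (Suc n * q) (app (mop (hankel q s n)) x) x))
      \<longleftrightarrow> psd q (hankel_kernel s) n"
    unfolding psd_def by (subst all_flat[OF assms(1)]) (simp only: ip_hankel[OF assms(2)])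
  ultimately show ?thesis
    unfolding nonneg_hermitian_iff using selfadj_hankel[of q n s, OF assms] by blast
qed

lemma pos_hermitian_hankel:
  assumes "1 \<le> q" "\<And>j. j \<le> 2 * n \<Longrightarrow> s j \<in> carrier_mat q q"
  shows "pos_hermitian (Suc n * q) (hankel q s n) \<longleftrightarrow>
    (\<forall>j\<le>2 * n. selfadj q (mop (s j))) \<and> pd q (hankel_kernel s) n"
proof -
  have nz: "(\<exists>i<Suc n * q. flat q x i \<noteq> 0) \<longleftrightarrow> (\<exists>j\<le>n. \<exists>i<q. x j i \<noteq> 0)" for x
  proof
    assume "\<exists>i<Suc n * q. flat q x i \<noteq> 0"
    then obtain i where "i < Suc n * q" "flat q x i \<noteq> 0" by blast
    then have "i div q < Suc n" "i mod q < q" "x (i div q) (i mod q) \<noteq> 0"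
      using assms(1) by (auto simp: flat_def less_mult_imp_div_less)
    then show "\<exists>j\<le>n. \<exists>i<q. x j i \<noteq> 0" using less_Suc_eq_le by blast
  next
    assume "\<exists>j\<le>n. \<exists>i<q. x j i \<noteq> 0"
    then obtain j i where "j < Suc n" "i < q" "x j i \<noteq> 0" using less_Suc_eq_le by blast
    then show "\<exists>i<Suc n * q. flat q x i \<noteq> 0"
      using block_index_less[of j "Suc n" i q] flat_index[of i q x j] by metis
  qed
  have "hankel q s n \<in> carrier_mat (Suc n * q) (Suc n * q)" by (simp only: hankel_def block_mat_carrier)
  moreover have "(\<forall>x. (\<exists>i<Suc n * q. x i \<noteq> 0) \<longrightarrow>
        0 < Re (ip (Suc n * q) (app (mop (hankel q s n)) x) x)) \<longleftrightarrow> pd q (hankel_kernel s) n"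
    unfolding pd_def by (subst all_flat[OF assms(1)]) (simp only: nz ip_hankel[OF assms(2)])
  ultimately show ?thesis
    unfolding pos_hermitian_iff using selfadj_hankel[of q n s, OF assms] by blast
qed

section \<open>Schur complements\<close>

text \<open>
  Minimising the form over all components but the last leaves the form of the Schur complement.
  This is completion of the square: with \<open>G\<close> the upper left block, \<open>b\<close> the off-diagonal
  column and \<open>X\<close> the Moore--Penrose inverse of \<open>G\<close>, the minimum is attained at
  \<open>Y = - X b z\<close>, because \<open>G X b = b\<close>.
\<close>

lemma hankel_schur_minimum:
  assumes q: "1 \<le> q" and car: "\<And>j. j \<le> 2 * n \<Longrightarrow> s j \<in> carrier_mat q q"
    and pos: "nonneg_hermitian (Suc n * q) (hankel q s n)"
  defines "L \<equiv> hankel_schur q s n"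
  shows "nonneg_hermitian q L"
    and "Re (ip q (app (mop L) (x n)) (x n)) \<le> Re (form q (hankel_kernel s) n x)"
    and "\<exists>x. x n = z \<and> Re (form q (hankel_kernel s) n x) = Re (ip q (app (mop L) z) z)"
proof -
  have sa: "\<And>j. j \<le> 2 * n \<Longrightarrow> selfadj q (mop (s j))" and psd: "psd q (hankel_kernel s) n"
    using pos nonneg_hermitian_hankel[of q n s, OF q car] by auto
  have main: "L \<in> carrier_mat q q \<and> selfadj q (mop L) \<and>
    (\<forall>x. Re (ip q (app (mop L) (x n)) (x n)) \<le> Re (form q (hankel_kernel s) n x)) \<and>
    (\<forall>z. \<exists>x. x n = z \<and> Re (form q (hankel_kernel s) n x) = Re (ip q (app (mop L) z) z))"
  proof (cases n)
    case 0
    have "form q (hankel_kernel s) n x = ip q (app (mop L) (x n)) (x n)" for x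
      using 0 by (simp add: form_def L_def hankel_schur_def)
    moreover have "\<exists>x. x n = z" for z :: "nat \<Rightarrow> complex" by (rule exI[of _ "\<lambda>_. z"]) simp
    ultimately show ?thesis
      using 0 car[of 0] sa[of 0] by (auto simp: L_def hankel_schur_def)
  next
    case (Suc n')
    define N where "N = n * q"
    define G where "G = hankel q s n'"
    define b where "b = block_mat q n 1 (\<lambda>j _. s (n + j))"
    define b' where "b' = block_mat q 1 n (\<lambda>_ k. s (n + k))"
    have G: "G \<in> carrier_mat N N" unfolding G_def N_def hankel_def Suc by (rule block_mat_carrier)
    have b: "b \<in> carrier_mat N q" "b' \<in> carrier_mat q N"
      using block_mat_carrier[of q n 1] block_mat_carrier[of q 1 n] by (simp_all add: b_def b'_def N_def)
    have adjG: "mat_adjoint G = G"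
    proof -
      have "mat_adjoint (s j) = s j" if "j \<le> 2 * n'" for j
        using car[of j] sa[of j] that Suc by (intro mat_adjoint_eq_self) auto
      then show ?thesis
        unfolding G_def using mat_adjoint_hankel[OF q, of n' s] car Suc by simp
    qed
    note X = mp_inverse_hermitian[OF G adjG]
    define \<gamma> where "\<gamma> = mop G"
    define X where "X = mop (mp_inverse G)"
    define \<beta> where "\<beta> = mop b"
    define \<beta>' where "\<beta>' = mop b'"
    define c where "c = mop (s (2 * n))"
    have sa\<gamma>: "selfadj N \<gamma>" and saX: "selfadj N X"
      unfolding \<gamma>_def X_def using selfadj_mop G adjG X by auto
    have adj\<beta>: "adj q N \<beta> \<beta>'"
    proof -
      have "b' = mat_adjoint b"
      proof (rule eq_matI)
        fix i k assume "i < dim_row (mat_adjoint b)" "k < dim_col (mat_adjoint b)"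
        then have i: "i < q" and k: "k < N" using b by auto
        then have kd: "k div q < n" "k mod q < q"
          using q by (auto simp: N_def less_mult_imp_div_less)
        then have le: "n + k div q \<le> 2 * n" by simp
        then have "mat_adjoint (s (n + k div q)) = s (n + k div q)"
          using mat_adjoint_eq_self sa car by blast
        then have "cnj (s (n + k div q) $$ (k mod q, i)) = s (n + k div q) $$ (i, k mod q)"
          using mat_adjoint_index[of i "s (n + k div q)" "k mod q"] car[OF le] i kd by simp
        then show "b' $$ (i, k) = mat_adjoint b $$ (i, k)"
          using i k b by (simp add: b_def b'_def block_mat_def N_def)
      qed (use b in auto)
      then show ?thesis unfolding \<beta>_def \<beta>'_def using adj_mop[OF b(1)] by simp
    qed
    have L_eq: "L = s (2 * n) - b' * mp_inverse G * b"
      using Suc by (simp add: L_def hankel_schur_def b_def b'_def G_def)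
    have prod: "b' * mp_inverse G * b \<in> carrier_mat q q" using b X(1) by auto
    then have Lc: "L \<in> carrier_mat q q" unfolding L_eq by (rule minus_carrier_mat)
    have L: "mop L = c - \<beta>' * X * \<beta>"
      using mop_minus[OF car[of "2 * n"] prod] b X(1)
      by (simp add: L_eq mop_mult c_def \<beta>_def \<beta>'_def X_def mult.assoc)
    have saL: "selfadj q (mop L)"
      unfolding L c_def
      using adj_minus[OF sa[of "2 * n"] adj_mult[OF adj_mult[OF adj_sym[OF adj\<beta>] saX] adj\<beta>]]
      by (simp add: mult.assoc)

    define \<Psi> where "\<Psi> Y z = ip N (app \<gamma> Y) Y + ip N (app \<beta> z) Y + ip q (app \<beta>' Y) z
        + ip q (app c z) z" for Y z
    have form: "form q (hankel_kernel s) n x = \<Psi> (flat q x) (x n)" for x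
    proof -
      have z: "app \<beta> (x n) = app \<beta> (flat q (\<lambda>_. x n))"
        unfolding \<beta>_def using b by (intro app_mop_cong) (auto simp: flat_def)
      have "ip N (app \<gamma> (flat q x)) (flat q x) = (\<Sum>j<n. \<Sum>k<n. ip q (app (mop (s (j + k))) (x k)) (x j))"
        unfolding \<gamma>_def G_def N_def Suc hankel_def
        using car Suc by (subst ip_block_mat) auto
      moreover have "ip N (app \<beta> (x n)) (flat q x) = (\<Sum>j<n. ip q (app (mop (s (n + j))) (x n)) (x j))"
        unfolding z unfolding \<beta>_def b_def N_def
        using car by (subst ip_block_mat) auto
      moreover have "ip q (app \<beta>' (flat q x)) (x n) = (\<Sum>k<n. ip q (app (mop (s (n + k))) (x k)) (x n))"
      proof -
        have "ip q (app \<beta>' (flat q x)) (x n) = ip (1 * q) (app \<beta>' (flat q x)) (flat q (\<lambda>_. x n))"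
          by (auto simp: flat_def intro!: ip_cong)
        also have "\<dots> = (\<Sum>j<1::nat. \<Sum>k<n. ip q (app (mop (s (n + k))) (x k)) (x n))"
          unfolding \<beta>'_def b'_def using car by (subst ip_block_mat) auto
        finally show ?thesis by simp
      qed
      moreover have "form q (hankel_kernel s) n x
        = (\<Sum>j<n. \<Sum>k<n. ip q (app (mop (s (j + k))) (x k)) (x j))
          + (\<Sum>j<n. ip q (app (mop (s (n + j))) (x n)) (x j))
          + (\<Sum>k<n. ip q (app (mop (s (n + k))) (x k)) (x n))
          + ip q (app (mop (s (2 * n))) (x n)) (x n)"
        unfolding form_def lessThan_Suc_atMost[symmetric]
        by (simp add: sum.distrib add.commute mult_2)
      ultimately show ?thesis by (simp add: \<Psi>_def c_def)
    qed
    have ex: "\<exists>x. x n = z \<and> form q (hankel_kernel s) n x = \<Psi> Y z" for Y z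
    proof -
      obtain y where y: "flat q y = Y" using flat_surj[OF q] by blast
      let ?x = "y(n := z)"
      have eq: "flat q ?x i = Y i" if "i < N" for i
      proof -
        have "i div q < n" using that by (simp add: N_def less_mult_imp_div_less)
        then show ?thesis using y by (auto simp: flat_def)
      qed
      have "app \<gamma> (flat q ?x) = app \<gamma> Y" "app \<beta>' (flat q ?x) = app \<beta>' Y"
        unfolding \<gamma>_def \<beta>'_def using G b eq by (auto intro!: app_mop_cong)
      then have "\<Psi> (flat q ?x) z = \<Psi> Y z"
        unfolding \<Psi>_def using eq by (simp add: ip_cong[OF refl eq])
      then show ?thesis using form[of ?x] by (intro exI[of _ ?x]) simp
    qed
    have \<Psi>_nonneg: "0 \<le> Re (\<Psi> Y z)" for Y z
      using ex[of z Y] psd unfolding psd_def by metis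

    \<comment> \<open>The part \<open>d\<close> of \<open>b z\<close> outside the range of \<open>G\<close> is annihilated by \<open>G\<close>, so the form is affine
      along \<open>d\<close> with slope \<open>2 \<parallel>d\<parallel>\<^sup>2\<close>; being bounded below, it forces \<open>d = 0\<close>.\<close>
    have range: "app \<gamma> (app X (app \<beta> z)) i = app \<beta> z i" if "i < N" for z i
    proof -
      define d where "d = app \<beta> z - app \<gamma> (app X (app \<beta> z))"
      have "G * (G * mp_inverse G) = G * (mp_inverse G * G)" by (simp only: X(5))
      also have "\<dots> = G * mp_inverse G * G" using X(1) G by (intro assoc_mult_mat[symmetric])
      finally have "G * (G * mp_inverse G) = G" by (simp only: X(2))
      then have "\<gamma> * (\<gamma> * X) = \<gamma>"
        unfolding \<gamma>_def X_def using G X(1) by (metis carrier_matD mop_mult mult_carrier_mat)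
      then have "app \<gamma> (app \<gamma> (app X w)) = app \<gamma> w" for w by (metis app_simps(4))
      then have \<gamma>d: "app \<gamma> d = 0" by (simp add: d_def app_diff_arg)
      have "app \<beta> z = d + app \<gamma> (app X (app \<beta> z))" by (simp add: d_def)
      then have "ip N (app \<beta> z) d = ip N d d + ip N (app \<gamma> (app X (app \<beta> z))) d"
        using ip_add_left by metis
      then have \<beta>d: "ip N (app \<beta> z) d = ip N d d" by (simp add: adjD[OF sa\<gamma>] \<gamma>d)
      have \<beta>'d: "ip q (app \<beta>' d) z = ip N d d"
        using \<beta>d ip_commute[of N d "app \<beta> z"] ip_commute[of N d d]
        by (simp add: adjD[OF adj_sym[OF adj\<beta>]])
      have "Re (ip N d d) = 0"
      proof (rule ccontr)
        assume "Re (ip N d d) \<noteq> 0"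
        define C where "C = Re (ip q (app c z) z)"
        define \<tau> where "\<tau> = (C + 1) / (2 * Re (ip N d d))"
        let ?Y = "\<lambda>i. complex_of_real (- \<tau>) * d i"
        have "\<Psi> ?Y z = - 2 * \<tau> * ip N d d + ip q (app c z) z"
          unfolding \<Psi>_def app_scale_arg ip_scale_left ip_scale_right \<gamma>d \<beta>d \<beta>'d by simp
        then have "Re (\<Psi> ?Y z) = - 2 * \<tau> * Re (ip N d d) + C" by (simp add: C_def)
        also have "\<dots> = -1" using \<open>Re (ip N d d) \<noteq> 0\<close> by (simp add: \<tau>_def field_simps)
        finally show False using \<Psi>_nonneg[of ?Y z] by simp
      qed
      then have "d i = 0" using ip_self_eq_0 that by blast
      then show ?thesis by (simp add: d_def)
    qed
    have square: "\<Psi> Y z = ip N (app \<gamma> (Y + app X (app \<beta> z))) (Y + app X (app \<beta> z))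
        + ip q (app (mop L) z) z" for Y z
    proof -
      let ?w = "app X (app \<beta> z)"
      have *: "ip N (app \<beta> z) u = ip N (app \<gamma> ?w) u" "ip N u (app \<beta> z) = ip N u (app \<gamma> ?w)" for u
        using range by (auto intro!: ip_cong)
      have "ip q (app (mop L) z) z = ip q (app c z - app \<beta>' ?w) z"
        unfolding L by (auto intro!: ip_cong)
      then have "ip q (app (mop L) z) z = ip q (app c z) z - ip N ?w (app \<gamma> ?w)"
        by (simp add: ip_diff_left adjD[OF adj_sym[OF adj\<beta>]] *)
      then show ?thesis
        unfolding \<Psi>_def
        by (simp add: app_add_arg ip_add_left ip_add_right adjD[OF adj_sym[OF adj\<beta>]] * adjD[OF sa\<gamma>])
    qed
    have \<gamma>_nonneg: "0 \<le> Re (ip N (app \<gamma> Y) Y)" for Y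
      using \<Psi>_nonneg[of Y 0] by (simp add: \<Psi>_def)
    have "Re (ip q (app (mop L) (x n)) (x n)) \<le> Re (form q (hankel_kernel s) n x)" for x
      using \<gamma>_nonneg unfolding form square by simp
    moreover have "\<exists>x. x n = z \<and> Re (form q (hankel_kernel s) n x) = Re (ip q (app (mop L) z) z)" for z
    proof -
      have "\<Psi> (- app X (app \<beta> z)) z = ip q (app (mop L) z) z"
        unfolding square by simp
      then show ?thesis using ex[of z "- app X (app \<beta> z)"] by metis
    qed
    ultimately show ?thesis using Lc saL by blast
  qed
  then show "Re (ip q (app (mop L) (x n)) (x n)) \<le> Re (form q (hankel_kernel s) n x)"
    and "\<exists>x. x n = z \<and> Re (form q (hankel_kernel s) n x) = Re (ip q (app (mop L) z) z)"
    by blast+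
  show "nonneg_hermitian q L"
    unfolding nonneg_hermitian_iff using main psd unfolding psd_def by metis
qed

lemma hankel_schur_eq_0_iff:
  assumes "1 \<le> q" "\<And>j. j \<le> 2 * n \<Longrightarrow> s j \<in> carrier_mat q q"
    and "nonneg_hermitian (Suc n * q) (hankel q s n)"
  shows "hankel_schur q s n = 0\<^sub>m q q \<longleftrightarrow> degenerate q (hankel_kernel s) n"
proof
  assume "hankel_schur q s n = 0\<^sub>m q q"
  then show "degenerate q (hankel_kernel s) n"
    unfolding degenerate_def using hankel_schur_minimum(3)[of q n s, OF assms] by simp
next
  assume *: "degenerate q (hankel_kernel s) n"
  let ?L = "hankel_schur q s n"
  note L = hankel_schur_minimum(1)[of q n s, OF assms]
  have "app (mop ?L) z i = 0" if "i < q" for z i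
  proof -
    obtain x where "x n = z" "Re (form q (hankel_kernel s) n x) = 0"
      using * unfolding degenerate_def by blast
    then have "Re (ip q (app (mop ?L) z) z) = 0"
      using hankel_schur_minimum(2)[of q n s x, OF assms] L unfolding nonneg_hermitian_iff
      by (metis order_antisym)
    then show ?thesis using nonneg_form_kernel[OF L _ that] by blast
  qed
  then show "?L = 0\<^sub>m q q"
    using L unfolding nonneg_hermitian_iff by (intro mop_inj[of _ q q]) auto
qed

section \<open>Reciprocal power series over a ring\<close>

text \<open>From here on, \<open>$\<close> denotes coefficients of power series.\<close>

no_notation vec_index (infixl "$" 100)
unbundle fps_syntax

lemma fps_mult_nth_atMost: "(f * g) $ n = (\<Sum>l\<le>n. f $ (n - l) * g $ l)"
  unfolding fps_mult_nth
  by (rule sum.reindex_bij_witness[of _ "\<lambda>l. n - l" "\<lambda>l. n - l"]) auto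

lemma fps_X_mult_cancel:
  fixes f g :: "'a :: ring_1 fps"
  assumes "fps_X * f = fps_X * g"
  shows "f = g"
proof (rule fps_ext)
  fix n
  have "(fps_X * f) $ Suc n = (fps_X * g) $ Suc n" using assms by simp
  then show "f $ n = g $ n" by simp
qed

lemma fps_X_mult_shift:
  fixes f :: "'a :: ring_1 fps"
  shows "fps_X * fps_shift (Suc m) f = fps_shift m f - fps_const (f $ m)"
proof (rule fps_ext)
  fix n
  show "(fps_X * fps_shift (Suc m) f) $ n = (fps_shift m f - fps_const (f $ m)) $ n"
    by (cases n) auto
qed

text \<open>
  Reciprocal series in the sense of generalised inverses: the products in both orders are a
  projection \<open>p\<close> onto the range of the leading coefficient rather than \<open>1\<close>.
\<close>

locale reciprocal_series =
  fixes S V :: "'a :: ring_1 fps" and p :: 'a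
  assumes SV: "S * V = fps_const p"
    and VS: "V * S = fps_const p"
    and pV: "fps_const p * V = V"
    and Vp: "V * fps_const p = V"
begin

lemma pV_nth: "p * V $ n = V $ n"
  using arg_cong[OF pV, of "\<lambda>f. f $ n"] by simp

lemma Vp_nth: "V $ n * p = V $ n"
  using arg_cong[OF Vp, of "\<lambda>f. f $ n"] by simp

lemma const_SV: "(\<Sum>m\<le>k. fps_const (S $ m) * fps_const (V $ (k - m))) = fps_const ((S * V) $ k)"
  by (simp add: fps_mult_nth atLeast0AtMost fps_eq_iff fps_sum_nth)

lemma X_commute: "V * (fps_X * f) = fps_X * (V * f)"
  by (metis fps_mult_fps_X_commute mult.assoc)

text \<open>
  Multiplied by \<open>(x - y)\<close>, this is the identity
  \<open>V x * (S x - S y) * V y = - (V x - V y)\<close> for two commuting indeterminates.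
\<close>

lemma divided_difference_kernel:
  "(\<Sum>l\<le>j. \<Sum>m\<le>k. V $ (j - l) * S $ Suc (l + m) * V $ (k - m)) = - V $ Suc (j + k)"
proof -
  define G where "G k = (\<Sum>m\<le>k. fps_shift (Suc m) S * fps_const (V $ (k - m)))" for k
  have G_nth: "G k $ l = (\<Sum>m\<le>k. S $ Suc (l + m) * V $ (k - m))" for k l
    by (simp add: G_def fps_sum_nth add.commute)
  have XG0: "fps_X * G 0 = S * fps_const (V $ 0) - fps_const p"
  proof -
    have "fps_X * G 0 = S * fps_const (V $ 0) - fps_const ((S * V) $ 0)"
      by (simp add: G_def mult.assoc[symmetric] fps_X_mult_shift left_diff_distrib)
    then show ?thesis by (simp add: SV)
  qed
  have XG: "fps_X * G (Suc k) = S * fps_const (V $ Suc k) + G k" for k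
  proof -
    have "fps_X * G (Suc k)
        = (\<Sum>m\<le>Suc k. (fps_shift m S - fps_const (S $ m)) * fps_const (V $ (Suc k - m)))"
      by (simp only: G_def sum_distrib_left mult.assoc[symmetric] fps_X_mult_shift)
    also have "\<dots> = (\<Sum>m\<le>Suc k. fps_shift m S * fps_const (V $ (Suc k - m)))
        - fps_const ((S * V) $ Suc k)"
      by (simp only: left_diff_distrib sum_subtractf const_SV)
    also have "\<dots> = S * fps_const (V $ Suc k) + G k"
      unfolding sum.atMost_Suc_shift by (simp add: G_def SV)
    finally show ?thesis .
  qed
  \<comment> \<open>\<open>G k\<close> is the coefficient of \<open>y\<^sup>k\<close> in \<open>(S x - S y) / (x - y) * V y\<close>.\<close>
  have VG: "V * G k = - fps_shift (Suc k) V" for k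
  proof (induction k)
    case 0
    have "fps_X * (V * G 0) = V * S * fps_const (V $ 0) - V * fps_const p"
      by (simp only: X_commute[symmetric] XG0 right_diff_distrib mult.assoc)
    also have "\<dots> = fps_const (V $ 0) - V"
      by (simp add: VS Vp pV_nth)
    also have "\<dots> = fps_X * (- fps_shift (Suc 0) V)"
      by (simp add: fps_X_mult_shift)
    finally show ?case by (rule fps_X_mult_cancel)
  next
    case (Suc k)
    have "fps_X * (V * G (Suc k)) = V * S * fps_const (V $ Suc k) + V * G k"
      by (simp only: X_commute[symmetric] XG distrib_left mult.assoc)
    also have "\<dots> = fps_const (V $ Suc k) - fps_shift (Suc k) V"
      by (simp add: VS Suc.IH pV_nth)
    also have "\<dots> = fps_X * (- fps_shift (Suc (Suc k)) V)"
      by (simp add: fps_X_mult_shift)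
    finally show ?case by (rule fps_X_mult_cancel)
  qed
  have "(\<Sum>l\<le>j. \<Sum>m\<le>k. V $ (j - l) * S $ Suc (l + m) * V $ (k - m)) = (V * G k) $ j"
    by (simp add: fps_mult_nth_atMost G_nth sum_distrib_left mult.assoc)
  then show ?thesis by (simp add: VG add.commute)
qed

text \<open>
  Here \<open>V x * (x * S x - y * S y) * V y = x * V y - y * V x\<close>: the row and the column
  of index \<open>0\<close> decouple from the rest.
\<close>

lemma shifted_divided_difference_kernel:
  "(\<Sum>l\<le>j. \<Sum>m\<le>k. V $ (j - l) * S $ (l + m) * V $ (k - m))
    = (if j = 0 \<and> k = 0 then V $ 0 else if j = 0 \<or> k = 0 then 0 else - V $ (j + k))"
proof -
  define F where "F k = (\<Sum>m\<le>k. fps_shift m S * fps_const (V $ (k - m)))" for k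
  have F_nth: "F k $ l = (\<Sum>m\<le>k. S $ (l + m) * V $ (k - m))" for k l
    by (simp add: F_def fps_sum_nth add.commute)
  have VF0: "V * F 0 = fps_const (V $ 0)"
  proof -
    have "V * F 0 = V * S * fps_const (V $ 0)" by (simp add: F_def mult.assoc)
    then show ?thesis by (simp add: VS pV_nth)
  qed
  have XF: "fps_X * F (Suc k) = fps_X * S * fps_const (V $ Suc k) + F k - fps_const ((S * V) $ k)" for k
  proof -
    have "fps_X * F (Suc k) = fps_X * S * fps_const (V $ Suc k)
        + (\<Sum>m\<le>k. fps_X * fps_shift (Suc m) S * fps_const (V $ (k - m)))"
      unfolding F_def sum.atMost_Suc_shift
      by (simp add: distrib_left sum_distrib_left mult.assoc)
    also have "(\<Sum>m\<le>k. fps_X * fps_shift (Suc m) S * fps_const (V $ (k - m)))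
        = F k - fps_const ((S * V) $ k)"
      by (simp only: fps_X_mult_shift left_diff_distrib sum_subtractf const_SV F_def)
    finally show ?thesis by simp
  qed
  have XVF: "fps_X * (V * F (Suc k))
      = fps_X * fps_const (V $ Suc k) + V * F k - V * fps_const ((S * V) $ k)" for k
  proof -
    have "fps_X * (V * F (Suc k))
        = V * (fps_X * (S * fps_const (V $ Suc k))) + V * F k - V * fps_const ((S * V) $ k)"
      by (simp only: X_commute[symmetric] XF distrib_left right_diff_distrib mult.assoc)
    also have "V * (fps_X * (S * fps_const (V $ Suc k))) = fps_X * (V * S * fps_const (V $ Suc k))"
      by (simp only: X_commute mult.assoc)
    finally show ?thesis by (simp add: VS pV_nth)
  qed
  have VF: "V * F (Suc k) = fps_const (V $ Suc k) - fps_shift (Suc k) V" for k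
  proof (induction k)
    case 0
    have "fps_X * (V * F (Suc 0)) = fps_X * fps_const (V $ Suc 0) + fps_const (V $ 0) - V"
      by (simp add: XVF VF0 SV Vp)
    also have "\<dots> = fps_X * (fps_const (V $ Suc 0) - fps_shift (Suc 0) V)"
      by (simp add: right_diff_distrib fps_X_mult_shift)
    finally show ?case by (rule fps_X_mult_cancel)
  next
    case (Suc k)
    have "fps_X * (V * F (Suc (Suc k)))
        = fps_X * fps_const (V $ Suc (Suc k)) + (fps_const (V $ Suc k) - fps_shift (Suc k) V)"
      by (simp add: XVF[of "Suc k"] Suc.IH SV)
    also have "\<dots> = fps_X * (fps_const (V $ Suc (Suc k)) - fps_shift (Suc (Suc k)) V)"
      by (simp add: right_diff_distrib fps_X_mult_shift)
    finally show ?case by (rule fps_X_mult_cancel)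
  qed
  have "(\<Sum>l\<le>j. \<Sum>m\<le>k. V $ (j - l) * S $ (l + m) * V $ (k - m)) = (V * F k) $ j"
    by (simp add: fps_mult_nth_atMost F_nth sum_distrib_left mult.assoc)
  also have "\<dots> = (if j = 0 \<and> k = 0 then V $ 0 else if j = 0 \<or> k = 0 then 0 else - V $ (j + k))"
    by (cases k) (auto simp: VF0 VF add.commute)
  finally show ?thesis .
qed

end

text \<open>
  The recursion says that \<open>S * V = p\<close>. For the other order, \<open>Y = V * S - p\<close> satisfies
  \<open>S * Y = 0\<close> and \<open>p * Y = Y\<close>, and the leading coefficient of \<open>S\<close> is injective on the range of
  \<open>p\<close>; so the coefficients of \<open>Y\<close> vanish one after another.
\<close>

lemma reciprocal_series_from_recursion:
  fixes S V :: "'a :: ring_1 fps"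
  assumes pS: "\<And>n. p * S $ n = S $ n" and Sp: "\<And>n. S $ n * p = S $ n"
    and g: "S $ 0 * g = p" "g * S $ 0 = p" "p * g = g" "g * p = g"
    and V0: "V $ 0 = g" and V: "\<And>n. 0 < n \<Longrightarrow> V $ n = - (g * (\<Sum>l<n. S $ (n - l) * V $ l))"
  shows "reciprocal_series S V p"
proof
  have "p * p = S $ 0 * (g * p)" by (simp only: g(1)[symmetric] mult.assoc)
  then have pp: "p * p = p" by (simp only: g(4) g(1))
  have pV: "p * V $ n = V $ n" for n
    using V0 V[of n] g(3) by (cases "n = 0") (auto simp: mult.assoc[symmetric])
  have Vp: "V $ n * p = V $ n" for n
  proof (induction n rule: less_induct)
    case (less n)
    show ?case
    proof (cases "n = 0")
      case False
      then have "V $ n * p = - (g * (\<Sum>l<n. S $ (n - l) * (V $ l * p)))"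
        using V[of n] by (simp add: mult.assoc sum_distrib_right)
      also have "\<dots> = V $ n" using less.IH V[of n] False by simp
      finally show ?thesis .
    qed (simp add: V0 g(4))
  qed
  show pV': "fps_const p * V = V" and Vp': "V * fps_const p = V"
    using pV Vp by (simp_all add: fps_eq_iff)
  show SV: "S * V = fps_const p"
  proof (rule fps_ext)
    fix n
    show "(S * V) $ n = fps_const p $ n"
    proof (cases "n = 0")
      case False
      have "(S * V) $ n = S $ 0 * V $ n + (\<Sum>l<n. S $ (n - l) * V $ l)"
        unfolding fps_mult_nth_atMost lessThan_Suc_atMost[symmetric] by (simp add: add.commute)
      also have "S $ 0 * V $ n = - (p * (\<Sum>l<n. S $ (n - l) * V $ l))"
        using False V[of n] g(1) by (simp add: mult.assoc[symmetric])
      also have "p * (\<Sum>l<n. S $ (n - l) * V $ l) = (\<Sum>l<n. S $ (n - l) * V $ l)"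
        using pS by (simp add: sum_distrib_left mult.assoc[symmetric])
      finally show ?thesis using False by simp
    qed (use g(1) V0 in simp)
  qed
  define Y where "Y = V * S - fps_const p"
  have "S * Y = fps_const p * S - S * fps_const p"
    by (simp add: Y_def right_diff_distrib SV flip: mult.assoc)
  then have SY: "S * Y = 0" using pS Sp by (simp add: fps_eq_iff)
  have pY: "p * Y $ n = Y $ n" for n
  proof -
    have "fps_const p * Y = Y"
      using pp by (simp add: Y_def right_diff_distrib pV' flip: mult.assoc)
    then have "(fps_const p * Y) $ n = Y $ n" by simp
    then show ?thesis by simp
  qed
  have "Y $ n = 0" for n
  proof (induction n rule: less_induct)
    case (less n)
    have "(S * Y) $ n = (\<Sum>l<n. S $ (n - l) * Y $ l) + S $ 0 * Y $ n"
      unfolding fps_mult_nth_atMost lessThan_Suc_atMost[symmetric] by simp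
    then have "S $ 0 * Y $ n = 0" using less.IH SY by simp
    then have "g * S $ 0 * Y $ n = 0" by (simp add: mult.assoc)
    then have "p * Y $ n = 0" by (simp only: g(2))
    then show ?case by (simp add: pY)
  qed
  then show "V * S = fps_const p" by (simp add: Y_def fps_eq_iff)
qed

section \<open>Congruences of block kernels\<close>

lemma form_cong_vectors:
  "(\<And>j. j \<le> n \<Longrightarrow> x j = y j) \<Longrightarrow> form q M n x = form q M n y"
  by (simp add: form_def)

lemma sum_triangle_swap:
  fixes f :: "nat \<Rightarrow> nat \<Rightarrow> 'a :: comm_monoid_add"
  shows "(\<Sum>j\<le>n. \<Sum>l\<le>j. f j l) = (\<Sum>l\<le>n. \<Sum>j\<in>{l..n}. f j l)"
  by (induction n) (simp_all add: sum.distrib add.assoc)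

text \<open>
  Application of the adjoint of a block lower triangular Toeplitz matrix. The entries \<open>b i\<close>
  are the adjoints of its blocks.
\<close>

definition toeplitz_apply ::
  "(nat \<Rightarrow> lop) \<Rightarrow> nat \<Rightarrow> (nat \<Rightarrow> nat \<Rightarrow> complex) \<Rightarrow> nat \<Rightarrow> nat \<Rightarrow> complex" where
  "toeplitz_apply b n x m = (\<Sum>k\<in>{m..n}. app (b (k - m)) (x k))"

lemma form_toeplitz:
  assumes M: "\<And>j k. j \<le> n \<Longrightarrow> k \<le> n \<Longrightarrow> M j k = (\<Sum>l\<le>j. \<Sum>m\<le>k. a (j - l) * N l m * b (k - m))"
    and ab: "\<And>i. i \<le> n \<Longrightarrow> adj q q (a i) (b i)"
  shows "form q M n x = form q N n (toeplitz_apply b n x)"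
proof -
  let ?T = "\<lambda>j l k m. ip q (app (N l m) (app (b (k - m)) (x k))) (app (b (j - l)) (x j))"
  have "ip q (app (M j k) (x k)) (x j) = (\<Sum>l\<le>j. \<Sum>m\<le>k. ?T j l k m)" if "j \<le> n" "k \<le> n" for j k
    using that by (simp add: M app_sum ip_sum_left adjD[OF ab])
  then have "form q M n x = (\<Sum>j\<le>n. \<Sum>k\<le>n. \<Sum>l\<le>j. \<Sum>m\<le>k. ?T j l k m)"
    by (simp add: form_def)
  also have "\<dots> = (\<Sum>j\<le>n. \<Sum>l\<le>j. \<Sum>k\<le>n. \<Sum>m\<le>k. ?T j l k m)"
    by (intro sum.cong refl sum.swap)
  also have "\<dots> = (\<Sum>j\<le>n. \<Sum>l\<le>j. \<Sum>m\<le>n. \<Sum>k\<in>{m..n}. ?T j l k m)"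
    by (simp only: sum_triangle_swap)
  also have "\<dots> = (\<Sum>l\<le>n. \<Sum>j\<in>{l..n}. \<Sum>m\<le>n. \<Sum>k\<in>{m..n}. ?T j l k m)"
    by (rule sum_triangle_swap)
  also have "\<dots> = (\<Sum>l\<le>n. \<Sum>m\<le>n. \<Sum>j\<in>{l..n}. \<Sum>k\<in>{m..n}. ?T j l k m)"
    by (intro sum.cong refl sum.swap)
  also have "\<dots> = form q N n (toeplitz_apply b n x)"
    by (simp only: form_def toeplitz_apply_def app_sum_arg ip_sum_left ip_sum_right)
  finally show ?thesis .
qed

text \<open>
Back substitution, starting from the last component.
\<close>

lemma toeplitz_apply_surj:
  assumes "b 0 = 1"
  shows "\<exists>x. \<forall>m\<le>n. toeplitz_apply b n x m = z m"
proof -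
  have "\<exists>x. \<forall>m. n - d \<le> m \<and> m \<le> n \<longrightarrow> toeplitz_apply b n x m = z m" for d
  proof (induction d)
    case 0
    show ?case by (rule exI[of _ z]) (auto simp: toeplitz_apply_def assms)
  next
    case (Suc d)
    then obtain x where x: "\<And>m. n - d \<le> m \<Longrightarrow> m \<le> n \<Longrightarrow> toeplitz_apply b n x m = z m" by blast
    show ?case
    proof (cases "d < n")
      case True
      define r where "r = n - Suc d"
      have r: "Suc r = n - d" "r \<le> n" using True by (auto simp: r_def)
      define x' where "x' = x(r := z r - (\<Sum>k\<in>{Suc r..n}. app (b (k - r)) (x k)))"
      have "toeplitz_apply b n x' m = z m" if "r \<le> m" "m \<le> n" for m
      proof (cases "m = r")
        case True
        have "toeplitz_apply b n x' r = x' r + (\<Sum>k\<in>{Suc r..n}. app (b (k - r)) (x' k))"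
          unfolding toeplitz_apply_def using r(2) by (simp add: sum.atLeast_Suc_atMost assms)
        also have "(\<Sum>k\<in>{Suc r..n}. app (b (k - r)) (x' k)) = (\<Sum>k\<in>{Suc r..n}. app (b (k - r)) (x k))"
          by (intro sum.cong) (auto simp: x'_def)
        also have "x' r = z r - (\<Sum>k\<in>{Suc r..n}. app (b (k - r)) (x k))" by (simp add: x'_def)
        finally show ?thesis using True by simp
      next
        case False
        then have "toeplitz_apply b n x' m = toeplitz_apply b n x m"
          using that unfolding toeplitz_apply_def by (intro sum.cong) (auto simp: x'_def)
        then show ?thesis using x[of m] r that False by simp
      qed
      then show ?thesis unfolding r_def by blast
    next
      case False
      then have "n - Suc d = n - d" by simp
      then show ?thesis using x by auto
    qed
  qed
  from this[of n] show ?thesis by simp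
qed

lemma adj_kernel:
  assumes "adj q q f g" "\<And>i. i < q \<Longrightarrow> x i = 0" "i < q"
  shows "app g x i = 0"
proof -
  have "app g x i = ip q (app g x) (unit_fun i)" using assms(3) by (simp add: ip_unit)
  also have "\<dots> = ip q x (app f (unit_fun i))" by (rule adjD[OF adj_sym[OF assms(1)]])
  also have "\<dots> = 0" using assms(2) by (simp add: ip_def)
  finally show ?thesis .
qed

text \<open>
  \<open>M\<close> is the congruent kernel \<open>A N A\<^sup>*\<close> with \<open>A\<close> block lower triangular Toeplitz with unit
  diagonal. Then \<open>A\<^sup>*\<close> is bijective and fixes the last component, which is what the
  three properties need.
\<close>

lemma toeplitz_congruence:
  assumes M: "\<And>j k. j \<le> n \<Longrightarrow> k \<le> n \<Longrightarrow> M j k = (\<Sum>l\<le>j. \<Sum>m\<le>k. a (j - l) * N l m * b (k - m))"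
    and ab: "\<And>i. i \<le> n \<Longrightarrow> adj q q (a i) (b i)" and b0: "b 0 = 1"
  shows "psd q N n \<Longrightarrow> psd q M n" "pd q N n \<Longrightarrow> pd q M n" "degenerate q N n \<Longrightarrow> degenerate q M n"
proof -
  have form: "form q M n x = form q N n (toeplitz_apply b n x)" for x
    by (rule form_toeplitz) (use M ab in auto)
  show "psd q N n \<Longrightarrow> psd q M n" by (simp add: psd_def form)
  show "pd q M n" if "pd q N n"
    unfolding pd_def
  proof (intro allI impI)
    fix x :: "nat \<Rightarrow> nat \<Rightarrow> complex" assume ex: "\<exists>j\<le>n. \<exists>i<q. x j i \<noteq> 0"
    define J where "J = (GREATEST j. j \<le> n \<and> (\<exists>i<q. x j i \<noteq> 0))"
    have J: "J \<le> n" "\<exists>i<q. x J i \<noteq> 0" and above: "\<And>k. k \<le> n \<Longrightarrow> J < k \<Longrightarrow> \<forall>i<q. x k i = 0"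
      using GreatestI_ex_nat[of "\<lambda>j. j \<le> n \<and> (\<exists>i<q. x j i \<noteq> 0)" n]
        Greatest_le_nat[of "\<lambda>j. j \<le> n \<and> (\<exists>i<q. x j i \<noteq> 0)" _ n] ex
      unfolding J_def by (auto simp: not_less[symmetric])
    \<comment> \<open>At the last nonzero component the substitution acts as the identity.\<close>
    have "toeplitz_apply b n x J i = x J i" if "i < q" for i
    proof -
      have "toeplitz_apply b n x J = x J + (\<Sum>k\<in>{Suc J..n}. app (b (k - J)) (x k))"
        unfolding toeplitz_apply_def using J(1) by (simp add: sum.atLeast_Suc_atMost b0)
      moreover have "(\<Sum>k\<in>{Suc J..n}. app (b (k - J)) (x k)) i = 0"
        unfolding sum_fun_apply
      proof (rule sum.neutral, rule ballI)
        fix k assume k: "k \<in> {Suc J..n}"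
        then have "k - J \<le> n" by (auto intro: le_trans[OF diff_le_self])
        with k show "app (b (k - J)) (x k) i = 0"
          using adj_kernel[OF ab[of "k - J"], of "x k" i] above[of k] that by auto
      qed
      ultimately show ?thesis by simp
    qed
    then have "\<exists>j\<le>n. \<exists>i<q. toeplitz_apply b n x j i \<noteq> 0" using J by metis
    then show "0 < Re (form q M n x)" using that unfolding pd_def form by blast
  qed
  show "degenerate q M n" if deg: "degenerate q N n"
    unfolding degenerate_def
  proof
    fix z
    obtain y where y: "y n = z" "Re (form q N n y) = 0"
      using deg unfolding degenerate_def by blast
    obtain x where x: "\<And>m. m \<le> n \<Longrightarrow> toeplitz_apply b n x m = y m"
      using toeplitz_apply_surj[of b, OF b0] by blast
    have "x n = z" using x[of n] y(1) by (simp add: toeplitz_apply_def b0)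
    moreover have "Re (form q M n x) = 0"
      using y(2) form_cong_vectors[of n "toeplitz_apply b n x" y q N] x by (simp add: form)
    ultimately show "\<exists>x. x n = z \<and> Re (form q M n x) = 0" by blast
  qed
qed

lemma bordered_kernel:
  assumes M0: "M0 0 0 = s" "\<And>k. k \<le> n \<Longrightarrow> M0 0 (Suc k) = 0" "\<And>j. j \<le> n \<Longrightarrow> M0 (Suc j) 0 = 0"
    and M: "\<And>j k. j \<le> n \<Longrightarrow> k \<le> n \<Longrightarrow> M0 (Suc j) (Suc k) = M j k"
  shows "psd q M0 (Suc n) \<Longrightarrow> psd q M n" "pd q M0 (Suc n) \<Longrightarrow> pd q M n"
    "psd q M0 (Suc n) \<Longrightarrow> degenerate q M0 (Suc n) \<Longrightarrow> degenerate q M n"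
proof -
  have form: "form q M0 (Suc n) x = ip q (app s (x 0)) (x 0) + form q M n (\<lambda>j. x (Suc j))" for x
    unfolding form_def sum.atMost_Suc_shift using M0 M by simp
  have form0: "form q M n x = form q M0 (Suc n) (case_nat 0 x)" for x
    by (simp add: form)
  show psd: "psd q M n" if "psd q M0 (Suc n)" using that by (simp add: psd_def form0)
  show "pd q M n" if pd0: "pd q M0 (Suc n)"
    unfolding pd_def
  proof (intro allI impI)
    fix x :: "nat \<Rightarrow> nat \<Rightarrow> complex" assume "\<exists>j\<le>n. \<exists>i<q. x j i \<noteq> 0"
    then have "\<exists>j\<le>Suc n. \<exists>i<q. case_nat 0 x j i \<noteq> 0" by (metis Suc_le_mono nat.case(2))
    then show "0 < Re (form q M n x)" using pd0 unfolding pd_def form0 by blast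
  qed
  show "degenerate q M n" if psd0: "psd q M0 (Suc n)" and deg0: "degenerate q M0 (Suc n)"
    unfolding degenerate_def
  proof
    fix z
    obtain x where x: "x (Suc n) = z" "Re (form q M0 (Suc n) x) = 0"
      using deg0 unfolding degenerate_def by blast
    have "0 \<le> Re (ip q (app s (x 0)) (x 0))"
    proof -
      have "form q M0 (Suc n) (\<lambda>j. if j = 0 then x 0 else 0) = ip q (app s (x 0)) (x 0)"
        unfolding form by (simp add: form_def)
      then show ?thesis using psd0 unfolding psd_def by metis
    qed
    moreover have "0 \<le> Re (form q M n (\<lambda>j. x (Suc j)))"
      using psd[OF psd0] by (simp add: psd_def)
    ultimately have "Re (form q M n (\<lambda>j. x (Suc j))) = 0" using x(2) by (simp add: form)
    then show "\<exists>x. x n = z \<and> Re (form q M n x) = 0"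
      using x(1) by (intro exI[of _ "\<lambda>j. x (Suc j)"]) simp
  qed
qed

lemma form_compressed:
  assumes "selfadj q p"
  shows "form q (\<lambda>j k. p * K j k * p) n x = form q K n (\<lambda>j. app p (x j))"
  by (simp add: form_def adjD[OF assms])

text \<open>
  A form vanishing at \<open>w\<close> need not vanish at the projection of \<open>w\<close>, so degeneracy is
  transferred under the condition that compression changes no block but the last diagonal one.
\<close>

lemma compressed_kernel:
  assumes p: "selfadj q p"
  shows "psd q K n \<Longrightarrow> psd q (\<lambda>j k. p * K j k * p) n"
    and "pd q K n \<Longrightarrow> (\<And>x. \<exists>i<q. x i \<noteq> 0 \<Longrightarrow> \<exists>i<q. app p x i \<noteq> 0) \<Longrightarrow> pd q (\<lambda>j k. p * K j k * p) n"
    and "degenerate q K n \<Longrightarrow> p * p = p \<Longrightarrow>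
      (\<And>j k. j + k < 2 * n \<Longrightarrow> K j k * p = K j k \<and> p * K j k = K j k) \<Longrightarrow>
      degenerate q (\<lambda>j k. p * K j k * p) n"
proof -
  note form = form_compressed[OF p]
  show "psd q K n \<Longrightarrow> psd q (\<lambda>j k. p * K j k * p) n" by (simp add: psd_def form)
  show "pd q (\<lambda>j k. p * K j k * p) n"
    if pdK: "pd q K n" and inj: "\<And>x. \<exists>i<q. x i \<noteq> 0 \<Longrightarrow> \<exists>i<q. app p x i \<noteq> 0"
    unfolding pd_def form
  proof (intro allI impI)
    fix x :: "nat \<Rightarrow> nat \<Rightarrow> complex" assume "\<exists>j\<le>n. \<exists>i<q. x j i \<noteq> 0"
    then have "\<exists>j\<le>n. \<exists>i<q. app p (x j) i \<noteq> 0" using inj by meson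
    then show "0 < Re (form q K n (\<lambda>j. app p (x j)))"
      using pdK unfolding pd_def by (metis (no_types))
  qed
  show "degenerate q (\<lambda>j k. p * K j k * p) n"
    if deg: "degenerate q K n" and pp: "p * p = p"
      and dom: "\<And>j k. j + k < 2 * n \<Longrightarrow> K j k * p = K j k \<and> p * K j k = K j k"
    unfolding degenerate_def
  proof
    fix z
    obtain w where w: "w n = app p z" "Re (form q K n w) = 0"
      using deg unfolding degenerate_def by blast
    have pw: "app p (w n) = w n" using w(1) pp by (metis app_simps(4))
    have "ip q (app (K j k) (app p (w k))) (app p (w j)) = ip q (app (K j k) (w k)) (w j)"
      if "j \<le> n" "k \<le> n" for j k
    proof (cases "j = n \<and> k = n")
      case True
      then show ?thesis by (simp add: pw)
    next
      case False
      then have *: "K j k * p = K j k" "p * K j k = K j k" using dom[of j k] that by auto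
      have "ip q (app (K j k) (app p (w k))) (app p (w j)) = ip q (app (p * (K j k * p)) (w k)) (w j)"
        by (simp add: adjD[OF p])
      then show ?thesis by (simp only: *)
    qed
    then have "form q (\<lambda>j k. p * K j k * p) n w = form q K n w"
      unfolding form by (simp add: form_def)
    moreover have "form q (\<lambda>j k. p * K j k * p) n (w(n := z)) = form q (\<lambda>j k. p * K j k * p) n w"
      unfolding form using w(1) pw by (intro form_cong_vectors) auto
    ultimately show "\<exists>x. x n = z \<and> Re (form q (\<lambda>j k. p * K j k * p) n x) = 0"
      using w(2) by (intro exI[of _ "w(n := z)"]) simp
  qed
qed

section \<open>The Schur transform of a Hermitian sequence\<close>

text \<open>
  The factors \<open>s * V $ i\<close> have the projection \<open>p\<close> on the diagonal. A kernel that is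
  compressed to the range of \<open>p\<close> does not distinguish \<open>p\<close> from \<open>1\<close>, so the diagonal may be
  replaced by \<open>1\<close>, which makes the congruence invertible.
\<close>

lemma (in reciprocal_series) unit_diagonal_congruence:
  assumes s: "s * V $ 0 = p" "V $ 0 * s = p"
    and N: "\<And>l m. p * N l m = N l m" "\<And>l m. N l m * p = N l m"
  shows "(\<Sum>l\<le>j. \<Sum>m\<le>k. (if j - l = 0 then 1 else s * V $ (j - l)) * N l m
            * (if k - m = 0 then 1 else V $ (k - m) * s))
       = s * (\<Sum>l\<le>j. \<Sum>m\<le>k. V $ (j - l) * N l m * V $ (k - m)) * s"
proof -
  have a: "(if i = 0 then 1 else s * V $ i) * N l m = s * (V $ i * N l m)" for i l m
    using s(1) N(1) by (cases "i = 0") (simp_all flip: mult.assoc)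
  have b: "N l m * (if i = 0 then 1 else V $ i * s) = N l m * V $ i * s" for i l m
    using N(2)[of l m] s(2) by (cases "i = 0") (simp_all add: mult.assoc)
  have "(if i = 0 then 1 else s * V $ i) * N l m * (if i' = 0 then 1 else V $ i' * s)
      = s * (V $ i * N l m * V $ i') * s" for i i' l m
    by (simp only: mult.assoc b) (simp only: a mult.assoc[symmetric])
  then show ?thesis by (simp only: sum_distrib_left sum_distrib_right)
qed

lemma shifted_carrier:
  "s j \<in> carrier_mat q q \<Longrightarrow> s (Suc j) \<in> carrier_mat q q \<Longrightarrow> shifted \<alpha> s j \<in> carrier_mat q q"
  by (simp add: shifted_def)

lemma selfadj_scal_mult: "selfadj q f \<Longrightarrow> selfadj q (scal (complex_of_real \<alpha>) * f)"
  using adj_mult[OF adj_scal_real[of q \<alpha>], of q f f] by (simp add: scal_central)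

lemma mop_shifted:
  assumes "r j \<in> carrier_mat q q" "r (Suc j) \<in> carrier_mat q q"
  shows "mop (shifted \<alpha> r j) = mop (r (Suc j)) - scal (complex_of_real \<alpha>) * mop (r j)"
proof -
  have "scal (- complex_of_real \<alpha>) = - scal (complex_of_real \<alpha>)" by (rule lop_eqI) simp
  then show ?thesis
    unfolding shifted_def using assms by (subst mop_add) (auto simp: mop_smult)
qed

text \<open>
  Notation for one Schur step. \<open>p\<close> is the orthogonal projection onto the range of \<open>s\<^sub>0\<close>,
  \<open>S\<close> is the generating series of the compressed sequence \<open>p s\<^sub>j p\<close>, \<open>U = (1 - \<alpha> x) S\<close> is its
  \<open>[+,\<alpha>]\<close>-transform, \<open>V\<close> is the series of the reciprocal sequence, \<open>W = (1 - \<alpha> x) V\<close> is the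
  reciprocal of \<open>S\<close>, and \<open>t\<close> is the Schur transform.
\<close>

locale hermitian_sequence =
  fixes q :: nat and \<alpha> :: real and s :: "nat \<Rightarrow> complex mat"
  assumes q: "1 \<le> q" and car: "\<And>j. s j \<in> carrier_mat q q" and herm: "\<And>j. mat_adjoint (s j) = s j"
begin

definition c :: lop where "c = scal (complex_of_real \<alpha>)"
definition s0 :: lop where "s0 = mop (s 0)"
definition g :: lop where "g = mop (mp_inverse (s 0))"
definition p :: lop where "p = s0 * g"
definition E :: "lop fps" where "E = 1 - fps_const c * fps_X"
definition S :: "lop fps" where "S = Abs_fps (\<lambda>j. p * mop (s j) * p)"
definition U :: "lop fps" where "U = E * S"
definition V :: "lop fps" where "V = Abs_fps (\<lambda>j. mop (reciprocal q (plus_transform q \<alpha> s) j))"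
definition W :: "lop fps" where "W = E * V"
definition t :: "nat \<Rightarrow> complex mat" where "t = schur_transform1 q \<alpha> s"

lemmas mp = mp_inverse_hermitian[OF car herm]

lemma range_projection:
  "s0 * g = p" "g * s0 = p" "p * g = g" "g * p = g" "p * s0 = s0" "s0 * p = s0" "p * p = p"
proof -
  have dims: "dim_row (s 0) = q" "dim_col (s 0) = q"
    "dim_row (mp_inverse (s 0)) = q" "dim_col (mp_inverse (s 0)) = q"
    using car[of 0] mp(1)[of 0] by auto
  have 1: "s0 * g * s0 = s0" "g * s0 * g = g" "g * s0 = s0 * g"
    using arg_cong[OF mp(2)[of 0], of mop] arg_cong[OF mp(3)[of 0], of mop]
      arg_cong[OF mp(5)[of 0], of mop] dims
    by (simp_all add: mop_mult s0_def g_def)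
  show p: "s0 * g = p" "g * s0 = p" using 1(3) by (simp_all only: p_def)
  show "p * g = g" by (simp only: p(2)[symmetric] 1(2))
  show gp: "g * p = g" by (simp only: p(1)[symmetric] mult.assoc[symmetric] 1(2))
  show "p * s0 = s0" by (simp only: p(1)[symmetric] 1(1))
  show "s0 * p = s0" by (simp only: p(2)[symmetric] mult.assoc[symmetric] 1(1))
  have "s0 * g * p = s0 * g" by (simp only: mult.assoc gp)
  then show "p * p = p" by (simp only: p(1))
qed

lemma c_central: "c * f = f * c"
  by (simp only: c_def scal_central)

lemma E_central: "E * f = f * E"
proof -
  have "fps_const c * f = f * fps_const c" for f by (rule fps_ext) (simp add: c_central)
  then show ?thesis
    unfolding E_def left_diff_distrib right_diff_distrib
    by (metis fps_mult_fps_X_commute mult.assoc mult_1_left mult_1_right)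
qed

lemma E_0 [simp]: "E $ 0 = 1"
  by (simp add: E_def)

lemma E_mult_nth: "(E * f) $ 0 = f $ 0" "(E * f) $ Suc j = f $ Suc j - c * f $ j"
  by (simp_all add: E_def left_diff_distrib mult.assoc)

lemma S_nth: "S $ j = p * mop (s j) * p"
  by (simp add: S_def)

lemma p_compressed: "p * (p * x * p) = p * x * p" "p * x * p * p = p * x * p"
proof -
  have "p * (p * x * p) = p * p * x * p" "p * x * p * p = p * x * (p * p)"
    by (simp_all only: mult.assoc)
  then show "p * (p * x * p) = p * x * p" "p * x * p * p = p * x * p"
    by (simp_all only: range_projection)
qed

lemma p_S: "p * S $ j = S $ j" "S $ j * p = S $ j"
  by (simp_all only: S_nth p_compressed)

lemma S_0: "S $ 0 = s0"
  using range_projection by (simp add: S_nth flip: s0_def)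

lemma U_shifted: "U $ Suc j = p * mop (shifted \<alpha> s j) * p"
proof -
  have "p * (c * mop (s j)) * p = c * (p * mop (s j) * p)"
    by (metis c_central mult.assoc)
  then show ?thesis
    using car by (simp add: U_def E_mult_nth S_nth mop_shifted[of s _ q] right_diff_distrib left_diff_distrib
        flip: c_def)
qed

lemma U_0: "U $ 0 = s0"
  by (simp add: U_def E_mult_nth S_0)

lemma p_U: "p * U $ j = U $ j" "U $ j * p = U $ j"
  by (cases j; simp only: U_0 U_shifted p_compressed range_projection)+

lemma plus_transform_eq:
  "plus_transform q \<alpha> s 0 = s 0" "plus_transform q \<alpha> s (Suc j) = shifted \<alpha> s j"
  using car[of 0] by (auto simp: plus_transform_def shifted_def)

lemma plus_carrier: "plus_transform q \<alpha> s j \<in> carrier_mat q q"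
  by (cases j) (simp_all add: plus_transform_eq car shifted_carrier)

lemma U_plus: "U $ j = p * mop (plus_transform q \<alpha> s j) * p"
  using range_projection by (cases j) (simp_all add: plus_transform_eq U_shifted U_0 flip: s0_def)

lemma reciprocal_carrier: "reciprocal q (plus_transform q \<alpha> s) j \<in> carrier_mat q q"
proof -
  have "mp_inverse (s 0) * mat q q f \<in> carrier_mat q q" for f
    using mp(1)[of 0] by simp
  then show ?thesis
    by (subst reciprocal.simps) (simp add: mp(1) plus_transform_eq)
qed

lemma V_0: "V $ 0 = g"
  by (simp add: V_def reciprocal.simps[of _ _ 0] plus_transform_eq g_def)

lemma V_plus:
  assumes "0 < n"
  shows "V $ n = - (g * (\<Sum>l<n. mop (plus_transform q \<alpha> s (n - l)) * V $ l))"
proof -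
  let ?u = "plus_transform q \<alpha> s"
  let ?M = "\<lambda>l. ?u (n - l) * reciprocal q ?u l"
  have M: "?M l \<in> carrier_mat q q" for l
    by (intro mult_carrier_mat[of _ q q] plus_carrier reciprocal_carrier)
  have "reciprocal q ?u n = - (mp_inverse (s 0) * mat q q (\<lambda>(a, b). \<Sum>l<n. ?M l $$ (a, b)))"
    using assms by (subst reciprocal.simps) (simp add: plus_transform_eq)
  then have "V $ n = - (g * (\<Sum>l<n. mop (?M l)))"
    using mp(1)[of 0] mop_sum[of "{..<n}" ?M q q] M
    by (simp add: V_def mop_uminus mop_mult g_def)
  also have "(\<Sum>l<n. mop (?M l)) = (\<Sum>l<n. mop (?u (n - l)) * V $ l)"
  proof (intro sum.cong refl)
    fix l
    have "dim_col (?u (n - l)) = dim_row (reciprocal q ?u l)"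
      using plus_carrier[of "n - l"] reciprocal_carrier[of l] by auto
    then show "mop (?M l) = mop (?u (n - l)) * V $ l" by (simp add: mop_mult V_def)
  qed
  finally show ?thesis .
qed

text \<open>
  Since \<open>g = g * p\<close> and \<open>V $ l = p * V $ l\<close>, the recursion only sees the compressions
  \<open>p * u * p\<close> of the coefficients.
\<close>

lemma V_recursion:
  assumes "0 < n"
  shows "V $ n = - (g * (\<Sum>l<n. U $ (n - l) * V $ l))"
proof -
  have pV: "p * V $ l = V $ l" for l
    using V_0 V_plus[of l] range_projection(3) by (cases "l = 0") (auto simp flip: mult.assoc)
  have "g * (mop (plus_transform q \<alpha> s i) * V $ l) = g * (U $ i * V $ l)" for i l
  proof -
    have "g * (U $ i * V $ l) = (g * p) * mop (plus_transform q \<alpha> s i) * (p * V $ l)"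
      by (simp only: U_plus mult.assoc)
    then show ?thesis by (simp only: range_projection(4) pV mult.assoc)
  qed
  then show ?thesis using V_plus[OF assms] by (simp add: sum_distrib_left)
qed

sublocale UV: reciprocal_series U V p
  using p_U range_projection V_0 V_recursion
  by (intro reciprocal_series_from_recursion[where g = g]) (auto simp: U_0)

sublocale SW: reciprocal_series S W p
proof
  have "S * W = E * S * V" by (simp only: W_def E_central mult.assoc)
  then show "S * W = fps_const p" using UV.SV by (simp add: U_def)
  have "W * S = V * (E * S)" by (simp only: W_def E_central mult.assoc)
  then show "W * S = fps_const p" using UV.VS by (simp add: U_def)
  have "fps_const p * W = E * (fps_const p * V)" by (simp only: W_def E_central mult.assoc)
  then show "fps_const p * W = W" by (simp add: UV.pV W_def)
  have "W * fps_const p = E * (V * fps_const p)" by (simp only: W_def mult.assoc)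
  then show "W * fps_const p = W" by (simp add: UV.Vp W_def)
qed

lemma selfadj_s: "selfadj q (mop (s j))"
  using selfadj_mop car herm by blast

lemma selfadj_g: "selfadj q g"
  unfolding g_def using selfadj_mop mp by blast

lemma selfadj_p: "selfadj q p"
  using adj_mult[OF selfadj_s[of 0] selfadj_g] range_projection by (simp flip: s0_def)

lemma selfadj_c_mult: "selfadj q f \<Longrightarrow> selfadj q (c * f)"
  unfolding c_def by (rule selfadj_scal_mult)

lemma selfadj_S: "selfadj q (S $ j)"
  using adj_mult[OF adj_mult[OF selfadj_p selfadj_s[of j]] selfadj_p] by (simp add: S_nth mult.assoc)

lemma selfadj_E_mult: "(\<And>j. selfadj q (f $ j)) \<Longrightarrow> selfadj q ((E * f) $ j)"
  by (cases j) (auto simp: E_mult_nth intro!: adj_minus selfadj_c_mult)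

text \<open>
  \<open>U * V = p\<close> and \<open>V * U = p\<close> give two recursions for \<open>V\<close> that are adjoint to each other.
\<close>

lemma selfadj_V: "selfadj q (V $ n)"
proof (induction n rule: less_induct)
  case (less n)
  show ?case
  proof (cases "n = 0")
    case False
    let ?A = "\<Sum>l<n. U $ (n - l) * V $ l" and ?B = "\<Sum>l<n. V $ l * U $ (n - l)"
    have "(V * U) $ n = ?B + V $ n * U $ 0"
      unfolding fps_mult_nth atLeast0AtMost lessThan_Suc_atMost[symmetric] by simp
    then have "V $ n * s0 = - ?B" using False by (simp add: UV.VS U_0 eq_neg_iff_add_eq_0 add.commute)
    then have "V $ n * s0 * g = - ?B * g" by simp
    then have VB: "V $ n = - (?B * g)"
      by (simp add: mult.assoc range_projection UV.Vp_nth)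
    have "adj q q ?A ?B"
      using less.IH selfadj_E_mult[OF selfadj_S] by (intro adj_sum adj_mult) (auto simp: U_def)
    then have "adj q q (- (g * ?A)) (- (?B * g))"
      by (rule adj_uminus[OF adj_mult[OF selfadj_g]])
    then show ?thesis using V_recursion[of n] VB False by simp
  qed (simp add: V_0 selfadj_g)
qed

lemma selfadj_W: "selfadj q (W $ n)"
  unfolding W_def using selfadj_V by (rule selfadj_E_mult)

lemma t_carrier: "t j \<in> carrier_mat q q"
  unfolding t_def schur_transform1_def
  by (intro uminus_carrier_mat mult_carrier_mat[of _ q q] car reciprocal_carrier)

lemma mop_t: "mop (t j) = - (s0 * V $ Suc j * s0)"
proof -
  have "dim_col (s 0) = dim_row (reciprocal q (plus_transform q \<alpha> s) (Suc j))"
    "dim_col (reciprocal q (plus_transform q \<alpha> s) (Suc j)) = dim_row (s 0)"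
    using car[of 0] reciprocal_carrier[of "Suc j"] by auto
  then show ?thesis
    by (simp add: t_def schur_transform1_def mop_uminus mop_mult V_def s0_def)
qed

lemma t_hermitian: "mat_adjoint (t j) = t j"
proof (rule mat_adjoint_eq_self[OF t_carrier])
  have "selfadj q (s0 * V $ Suc j * s0)"
    using adj_mult[OF adj_mult[OF selfadj_s[of 0] selfadj_V[of "Suc j"]] selfadj_s[of 0]]
    by (simp add: s0_def mult.assoc)
  then show "selfadj q (mop (t j))" unfolding mop_t by (rule adj_uminus)
qed

lemma mop_shifted_t: "mop (shifted \<alpha> t j) = - (s0 * W $ (j + 2) * s0)"
proof -
  have "s0 * (c * x) = c * (s0 * x)" for x by (metis c_central mult.assoc)
  then show ?thesis
    by (simp add: mop_shifted[of t _ q] t_carrier mop_t W_def E_mult_nth right_diff_distrib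
        left_diff_distrib mult.assoc flip: c_def)
qed

definition row_coeff :: "lop fps \<Rightarrow> nat \<Rightarrow> lop" where
  "row_coeff F i = (if i = 0 then 1 else s0 * F $ i)"

definition col_coeff :: "lop fps \<Rightarrow> nat \<Rightarrow> lop" where
  "col_coeff F i = (if i = 0 then 1 else F $ i * s0)"

lemma adj_coeff: "(\<And>i. selfadj q (F $ i)) \<Longrightarrow> adj q q (row_coeff F i) (col_coeff F i)"
  using adj_mult[OF selfadj_s[of 0], of q "F $ i" "F $ i"]
  by (auto simp: row_coeff_def col_coeff_def adj_one s0_def)

text \<open>
  The Hankel matrix of \<open>t\<close> is congruent to the compressed Hankel matrix of the shifted sequence
  of \<open>s\<close>: the latter is the divided difference kernel of \<open>U\<close>, as \<open>u\<^sub>j\<^sub>+\<^sub>1\<close> is the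
  shifted sequence.
\<close>

lemma kernel_t:
  "mop (t (j + k)) = (\<Sum>l\<le>j. \<Sum>m\<le>k.
     row_coeff V (j - l) * (p * mop (shifted \<alpha> s (l + m)) * p) * col_coeff V (k - m))"
proof -
  have "(\<Sum>l\<le>j. \<Sum>m\<le>k. row_coeff V (j - l) * (p * mop (shifted \<alpha> s (l + m)) * p) * col_coeff V (k - m))
      = s0 * (\<Sum>l\<le>j. \<Sum>m\<le>k. V $ (j - l) * U $ Suc (l + m) * V $ (k - m)) * s0"
    unfolding row_coeff_def col_coeff_def U_shifted[symmetric]
    by (rule UV.unit_diagonal_congruence) (simp_all add: V_0 range_projection p_U)
  then show ?thesis by (simp add: UV.divided_difference_kernel mop_t)
qed

text \<open>
  The compressed Hankel matrix of \<open>s\<close> transformed by \<open>W\<close>. It turns out to be block diagonal with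
  blocks \<open>s\<^sub>0\<close> and the Hankel matrix of the shifted sequence of \<open>t\<close>, which is one size smaller.
\<close>

definition bordered :: "nat \<Rightarrow> nat \<Rightarrow> lop" where
  "bordered j k = (\<Sum>l\<le>j. \<Sum>m\<le>k.
     row_coeff W (j - l) * (p * mop (s (l + m)) * p) * col_coeff W (k - m))"

lemma bordered_eq:
  "bordered 0 0 = s0" "bordered 0 (Suc k) = 0" "bordered (Suc j) 0 = 0"
  "bordered (Suc j) (Suc k) = mop (shifted \<alpha> t (j + k))"
proof -
  have W_0: "W $ 0 = g" by (simp add: W_def E_mult_nth V_0)
  have "bordered j k = s0 * (\<Sum>l\<le>j. \<Sum>m\<le>k. W $ (j - l) * S $ (l + m) * W $ (k - m)) * s0" for j k
    unfolding bordered_def row_coeff_def col_coeff_def S_nth[symmetric]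
    by (rule SW.unit_diagonal_congruence) (simp_all add: W_0 range_projection p_S)
  then show "bordered 0 0 = s0" "bordered 0 (Suc k) = 0" "bordered (Suc j) 0 = 0"
    "bordered (Suc j) (Suc k) = mop (shifted \<alpha> t (j + k))"
    by (simp_all only: SW.shifted_divided_difference_kernel)
      (simp_all add: W_0 range_projection mop_shifted_t)
qed

lemma transfer_t:
  fixes n
  defines "K \<equiv> \<lambda>j k. p * mop (shifted \<alpha> s (j + k)) * p"
  shows "psd q K n \<Longrightarrow> psd q (hankel_kernel t) n" "pd q K n \<Longrightarrow> pd q (hankel_kernel t) n"
    "degenerate q K n \<Longrightarrow> degenerate q (hankel_kernel t) n"
  using toeplitz_congruence[of n "hankel_kernel t" "row_coeff V" K "col_coeff V" q]
    adj_coeff[of V, OF selfadj_V] kernel_t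
  by (auto simp: K_def col_coeff_def)

lemma transfer_shifted_t:
  fixes n
  defines "K \<equiv> \<lambda>j k. p * mop (s (j + k)) * p"
  shows "psd q K (Suc n) \<Longrightarrow> psd q (hankel_kernel (shifted \<alpha> t)) n"
    "pd q K (Suc n) \<Longrightarrow> pd q (hankel_kernel (shifted \<alpha> t)) n"
    "psd q K (Suc n) \<Longrightarrow> degenerate q K (Suc n) \<Longrightarrow> degenerate q (hankel_kernel (shifted \<alpha> t)) n"
proof -
  note cong = toeplitz_congruence[of "Suc n" bordered "row_coeff W" K "col_coeff W" q]
  have "psd q K (Suc n) \<Longrightarrow> psd q bordered (Suc n)" "pd q K (Suc n) \<Longrightarrow> pd q bordered (Suc n)"
    "degenerate q K (Suc n) \<Longrightarrow> degenerate q bordered (Suc n)"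
    using cong adj_coeff[of W, OF selfadj_W] by (auto simp: K_def col_coeff_def bordered_def)
  moreover note bordered_kernel[of bordered s0 n "hankel_kernel (shifted \<alpha> t)" q]
  ultimately show "psd q K (Suc n) \<Longrightarrow> psd q (hankel_kernel (shifted \<alpha> t)) n"
    "pd q K (Suc n) \<Longrightarrow> pd q (hankel_kernel (shifted \<alpha> t)) n"
    "psd q K (Suc n) \<Longrightarrow> degenerate q K (Suc n) \<Longrightarrow> degenerate q (hankel_kernel (shifted \<alpha> t)) n"
    by (simp_all add: bordered_eq)
qed

text \<open>
  \<open>x - p x\<close> lies in the kernel of \<open>s\<^sub>0\<close>; the second identity is the adjoint of the first.
\<close>

lemma dominated:
  assumes "\<And>v. app s0 v = 0 \<Longrightarrow> app (mop (s j)) v = 0"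
  shows "mop (s j) * p = mop (s j)" "p * mop (s j) = mop (s j)"
proof -
  define P where "P = s 0 * mp_inverse (s 0)"
  have P: "P \<in> carrier_mat q q" unfolding P_def using car[of 0] mp(1)[of 0] by simp
  have mopP: "mop P = p"
    unfolding P_def p_def s0_def g_def using car[of 0] mp(1)[of 0] by (intro mop_mult) auto
  show *: "mop (s j) * p = mop (s j)"
  proof (rule lop_eqI)
    fix x i
    have "app s0 (app p x) = app s0 x" using range_projection(6) by (metis app_simps(4))
    then have "app s0 (x - app p x) = 0" by (simp add: app_diff_arg)
    then have "app (mop (s j)) (x - app p x) = 0" by (rule assms)
    then show "app (mop (s j) * p) x i = app (mop (s j)) x i" by (simp add: app_diff_arg)
  qed
  have mm: "mop (s j * P) = mop (s j) * p" "mop (P * s j) = p * mop (s j)"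
    using car[of j] P by (simp_all add: mop_mult mopP)
  have "s j * P = s j"
    by (rule mop_inj[of _ q q]) (use car[of j] P mm * in auto)
  then have "mat_adjoint P * s j = s j"
    using mat_adjoint_mult[of "s j" P] car[of j] P herm[of j] by simp
  then show "p * mop (s j) = mop (s j)" using mm(2) mp(6)[of 0] by (simp add: P_def)
qed

lemma p_injective:
  assumes pd: "pd q (hankel_kernel s) n" and x: "\<exists>i<q. x i \<noteq> 0"
  shows "\<exists>i<q. app p x i \<noteq> 0"
proof (rule ccontr)
  assume "\<not> ?thesis"
  then have "app s0 (app p x) = app s0 0"
    unfolding s0_def using car[of 0] by (intro app_mop_cong) auto
  then have "app s0 x = 0" using range_projection(6) by (metis app_simps(4) app_zero_arg)
  define y where "y = (\<lambda>j :: nat. if j = 0 then x else 0)"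
  have "ip q (app (hankel_kernel s j k) (y k)) (y j) = 0" for j k
    using \<open>app s0 x = 0\<close> by (simp add: y_def s0_def)
  then have "form q (hankel_kernel s) n y = 0"
    unfolding form_def by (intro sum.neutral ballI) blast
  moreover have "\<exists>j\<le>n. \<exists>i<q. y j i \<noteq> 0" using x by (intro exI[of _ 0]) (simp add: y_def)
  ultimately show False using pd unfolding pd_def by fastforce
qed

lemma nonneg_transfer:
  "psd q (hankel_kernel (shifted \<alpha> s)) n \<Longrightarrow> psd q (hankel_kernel t) n"
  "psd q (hankel_kernel s) (Suc n) \<Longrightarrow> psd q (hankel_kernel (shifted \<alpha> t)) n"
  using compressed_kernel(1)[OF selfadj_p] transfer_t(1) transfer_shifted_t(1) by blast+

lemma pos_transfer:
  assumes "pd q (hankel_kernel s) n'"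
  shows "pd q (hankel_kernel (shifted \<alpha> s)) n \<Longrightarrow> pd q (hankel_kernel t) n"
    "pd q (hankel_kernel s) (Suc n) \<Longrightarrow> pd q (hankel_kernel (shifted \<alpha> t)) n"
  using compressed_kernel(2)[OF selfadj_p _ p_injective[OF assms]] transfer_t(2) transfer_shifted_t(2)
  by blast+

text \<open>
  In both cases entries beyond \<open>s\<^sub>m\<close> occur at most in the last diagonal block of the kernel,
  so domination of the entries up to \<open>s\<^sub>m\<close> allows to pass to the compression.
\<close>

lemma degenerate_transfer:
  assumes dom: "\<And>j v. j \<le> m \<Longrightarrow> app s0 v = 0 \<Longrightarrow> app (mop (s j)) v = 0"
  shows "2 * n \<le> m \<Longrightarrow> degenerate q (hankel_kernel (shifted \<alpha> s)) n \<Longrightarrow> degenerate q (hankel_kernel t) n"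
    "Suc (2 * n) \<le> m \<Longrightarrow> psd q (hankel_kernel s) (Suc n) \<Longrightarrow> degenerate q (hankel_kernel s) (Suc n)
      \<Longrightarrow> degenerate q (hankel_kernel (shifted \<alpha> t)) n"
proof -
  have sp: "mop (s j) * p = mop (s j)" "p * mop (s j) = mop (s j)" if "j \<le> m" for j
    using dominated dom[OF that] by blast+
  have ap: "mop (shifted \<alpha> s j) * p = mop (shifted \<alpha> s j)" "p * mop (shifted \<alpha> s j) = mop (shifted \<alpha> s j)"
    if "Suc j \<le> m" for j
  proof -
    have "p * (c * x) = c * (p * x)" for x by (metis c_central mult.assoc)
    then show "mop (shifted \<alpha> s j) * p = mop (shifted \<alpha> s j)" "p * mop (shifted \<alpha> s j) = mop (shifted \<alpha> s j)"
      using sp[of j] sp[of "Suc j"] that car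
      by (simp_all add: mop_shifted[of s _ q] right_diff_distrib left_diff_distrib mult.assoc
          flip: c_def)
  qed
  note comp = compressed_kernel(3)[OF selfadj_p _ range_projection(7)]
  show "degenerate q (hankel_kernel t) n"
    if "2 * n \<le> m" "degenerate q (hankel_kernel (shifted \<alpha> s)) n"
    using comp[OF that(2)] ap that(1) by (intro transfer_t(3)) auto
  show "degenerate q (hankel_kernel (shifted \<alpha> t)) n"
    if "Suc (2 * n) \<le> m" "psd q (hankel_kernel s) (Suc n)" "degenerate q (hankel_kernel s) (Suc n)"
    using comp[OF that(3)] sp that(1) compressed_kernel(1)[OF selfadj_p that(2)]
    by (intro transfer_shifted_t(3)) auto
qed

end

section \<open>The classes of Stieltjes nonnegative and positive definite sequences\<close>

lemma kernel_property_cong: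
  assumes "\<And>j k. j \<le> n \<Longrightarrow> k \<le> n \<Longrightarrow> M j k = N j k"
  shows "psd q M n = psd q N n" "pd q M n = pd q N n" "degenerate q M n = degenerate q N n"
  unfolding psd_def pd_def degenerate_def using form_cong[of n M N q] assms by auto

lemma selfadj_shifted_iff:
  assumes "s j \<in> carrier_mat q q" "s (Suc j) \<in> carrier_mat q q" "selfadj q (mop (s j))"
  shows "selfadj q (mop (shifted \<alpha> s j)) \<longleftrightarrow> selfadj q (mop (s (Suc j)))"
proof -
  let ?f = "scal (complex_of_real \<alpha>) * mop (s j)"
  have f: "selfadj q ?f" using assms(3) by (rule selfadj_scal_mult)
  have "mop (shifted \<alpha> s j) = mop (s (Suc j)) - ?f" using assms by (simp add: mop_shifted[of s _ q])
  then show ?thesis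
    using adj_add[OF _ f, of "mop (shifted \<alpha> s j)" "mop (shifted \<alpha> s j)"]
      adj_minus[OF _ f, of "mop (s (Suc j))" "mop (s (Suc j))"] by auto
qed

lemma selfadj_upto_iff:
  assumes car: "\<And>j. j \<le> m \<Longrightarrow> s j \<in> carrier_mat q q"
  shows "(\<forall>j\<le>2 * (m div 2). selfadj q (mop (s j))) \<and>
      (1 \<le> m \<longrightarrow> (\<forall>j\<le>2 * ((m - 1) div 2). selfadj q (mop (shifted \<alpha> s j)))) \<longleftrightarrow>
    (\<forall>j\<le>m. selfadj q (mop (s j)))" (is "?L \<longleftrightarrow> ?R")
proof
  assume L: ?L
  show ?R
  proof (intro allI impI)
    fix j assume "j \<le> m"
    then consider "j \<le> 2 * (m div 2)" | i where "j = Suc i" "m = Suc i" "even i"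
      by (cases "even m"; cases "j = m") (auto elim!: oddE)
    then show "selfadj q (mop (s j))"
    proof cases
      case 2
      then have "selfadj q (mop (shifted \<alpha> s i))" "selfadj q (mop (s i))" using L by auto
      then show ?thesis using selfadj_shifted_iff[of s i q \<alpha>] car 2 by auto
    qed (use L in blast)
  qed
next
  assume R: ?R
  have "selfadj q (mop (shifted \<alpha> s j))" if "1 \<le> m" "j \<le> 2 * ((m - 1) div 2)" for j
  proof -
    have "Suc j \<le> m" using that by linarith
    then show ?thesis using selfadj_shifted_iff[of s j q \<alpha>] car R by auto
  qed
  moreover have "2 * (m div 2) \<le> m" by simp
  ultimately show ?L using R by (meson le_trans)
qed

text \<open>
  The index \<open>(m - 1) div 2\<close> of the shifted Hankel matrix covers both parities of \<open>m\<close>.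
\<close>

lemma stieltjes_fin_iff:
  assumes q: "1 \<le> q" and car: "\<And>j. j \<le> m \<Longrightarrow> s j \<in> carrier_mat q q"
  shows "stieltjes_nonneg_fin q m \<alpha> s \<longleftrightarrow>
      (\<forall>j\<le>m. selfadj q (mop (s j))) \<and> psd q (hankel_kernel s) (m div 2) \<and>
      (1 \<le> m \<longrightarrow> psd q (hankel_kernel (shifted \<alpha> s)) ((m - 1) div 2))"
    and "stieltjes_pos_fin q m \<alpha> s \<longleftrightarrow>
      (\<forall>j\<le>m. selfadj q (mop (s j))) \<and> pd q (hankel_kernel s) (m div 2) \<and>
      (1 \<le> m \<longrightarrow> pd q (hankel_kernel (shifted \<alpha> s)) ((m - 1) div 2))"
proof -
  have shifted_index: "(if even m then m div 2 \<ge> 1 \<longrightarrow> P (m div 2 * q) (m div 2 - 1)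
      else P (Suc (m div 2) * q) (m div 2)) \<longleftrightarrow>
      (1 \<le> m \<longrightarrow> P (Suc ((m - 1) div 2) * q) ((m - 1) div 2))" for P :: "nat \<Rightarrow> nat \<Rightarrow> bool"
  proof (cases "even m")
    case True
    then obtain n where "m = 2 * n" by blast
    then show ?thesis by (cases n) auto
  qed (auto elim!: oddE)
  have "s j \<in> carrier_mat q q" if "j \<le> 2 * (m div 2)" for j using car that by auto
  note H = nonneg_hermitian_hankel[of q "m div 2" s, OF q this]
    pos_hermitian_hankel[of q "m div 2" s, OF q this]
  have "shifted \<alpha> s j \<in> carrier_mat q q" if "1 \<le> m" "j \<le> 2 * ((m - 1) div 2)" for j
  proof -
    have "Suc j \<le> m" using that by linarith
    then show ?thesis using car by (intro shifted_carrier) auto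
  qed
  note HS = nonneg_hermitian_hankel[of q "(m - 1) div 2" "shifted \<alpha> s", OF q this]
    pos_hermitian_hankel[of q "(m - 1) div 2" "shifted \<alpha> s", OF q this]
  note sa = selfadj_upto_iff[of m s q \<alpha>, OF car, symmetric]
  show "stieltjes_nonneg_fin q m \<alpha> s \<longleftrightarrow>
      (\<forall>j\<le>m. selfadj q (mop (s j))) \<and> psd q (hankel_kernel s) (m div 2) \<and>
      (1 \<le> m \<longrightarrow> psd q (hankel_kernel (shifted \<alpha> s)) ((m - 1) div 2))"
    unfolding stieltjes_nonneg_fin_def Let_def
      shifted_index[of "\<lambda>a b. nonneg_hermitian a (hankel q (shifted \<alpha> s) b)"]
    using car H(1) HS(1) sa by blast
  show "stieltjes_pos_fin q m \<alpha> s \<longleftrightarrow>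
      (\<forall>j\<le>m. selfadj q (mop (s j))) \<and> pd q (hankel_kernel s) (m div 2) \<and>
      (1 \<le> m \<longrightarrow> pd q (hankel_kernel (shifted \<alpha> s)) ((m - 1) div 2))"
    unfolding stieltjes_pos_fin_def Let_def
      shifted_index[of "\<lambda>a b. pos_hermitian a (hankel q (shifted \<alpha> s) b)"]
    using car H(2) HS(2) sa by blast
qed

lemma stieltjes_fin_carrier:
  "stieltjes_nonneg_fin q m \<alpha> s \<Longrightarrow> j \<le> m \<Longrightarrow> s j \<in> carrier_mat q q"
  "stieltjes_pos_fin q m \<alpha> s \<Longrightarrow> j \<le> m \<Longrightarrow> s j \<in> carrier_mat q q"
  by (simp_all add: stieltjes_nonneg_fin_def stieltjes_pos_fin_def)

lemma stieltjes_cd_fin_iff: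
  assumes q: "1 \<le> q"
  shows "stieltjes_cd_fin q m \<alpha> s \<longleftrightarrow> stieltjes_nonneg_fin q m \<alpha> s \<and>
    (if even m then degenerate q (hankel_kernel s) (m div 2)
     else degenerate q (hankel_kernel (shifted \<alpha> s)) (m div 2))"
proof (cases "stieltjes_nonneg_fin q m \<alpha> s")
  case nonneg: True
  note car = stieltjes_fin_carrier(1)[OF nonneg]
  have "s j \<in> carrier_mat q q" if "j \<le> 2 * (m div 2)" for j using car that by auto
  moreover have "shifted \<alpha> s j \<in> carrier_mat q q" if "odd m" "j \<le> 2 * (m div 2)" for j
    using car that by (intro shifted_carrier) (auto elim!: oddE)
  ultimately show ?thesis
    using nonneg hankel_schur_eq_0_iff[of q "m div 2" s, OF q]
      hankel_schur_eq_0_iff[of q "m div 2" "shifted \<alpha> s", OF q]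
    unfolding stieltjes_cd_fin_def by (auto simp: stieltjes_nonneg_fin_def Let_def)
qed (simp add: stieltjes_cd_fin_def)

lemma stieltjes_nonneg_fin_cong:
  assumes q: "1 \<le> q" and eq: "\<And>j. j \<le> m \<Longrightarrow> s j = s' j" and s: "stieltjes_nonneg_fin q m \<alpha> s"
  shows "stieltjes_nonneg_fin q m \<alpha> s'"
proof -
  have car: "s j \<in> carrier_mat q q" "s' j \<in> carrier_mat q q" if "j \<le> m" for j
    using stieltjes_fin_carrier(1)[OF s that] eq[OF that] by auto
  have "psd q (hankel_kernel s) (m div 2) = psd q (hankel_kernel s') (m div 2)"
    by (intro kernel_property_cong) (simp add: eq)
  moreover have "psd q (hankel_kernel (shifted \<alpha> s)) ((m - 1) div 2)
      = psd q (hankel_kernel (shifted \<alpha> s')) ((m - 1) div 2)" if "1 \<le> m"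
  proof (intro kernel_property_cong)
    fix j k assume "j \<le> (m - 1) div 2" "k \<le> (m - 1) div 2"
    then have "Suc (j + k) \<le> m" using that by linarith
    then show "mop (shifted \<alpha> s (j + k)) = mop (shifted \<alpha> s' (j + k))"
      by (simp add: shifted_def eq)
  qed
  ultimately show ?thesis
    using s stieltjes_fin_iff(1)[of q m s \<alpha>, OF q car(1)] stieltjes_fin_iff(1)[of q m s' \<alpha>, OF q car(2)] eq
    by auto
qed

section \<open>Domination by the first coefficient\<close>

text \<open>
  The vector with the single nonzero component \<open>v\<close> at position \<open>i\<close> makes the form vanish,
  hence is annihilated by the Hankel matrix.
\<close>

lemma hankel_column_kernel:
  assumes q: "1 \<le> q" and car: "\<And>j. j \<le> 2 * n \<Longrightarrow> r j \<in> carrier_mat q q"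
    and pos: "nonneg_hermitian (Suc n * q) (hankel q r n)"
    and v: "app (mop (r (2 * i))) v = 0" and ij: "i \<le> n" "j \<le> n"
  shows "app (mop (r (i + j))) v = 0"
proof
  fix a
  show "app (mop (r (i + j))) v a = 0 a"
  proof (cases "a < q")
    case True
    define x where "x = (\<lambda>k. if k = i then v else 0)"
    have "form q (hankel_kernel r) n x = 0"
      unfolding form_def
    proof (intro sum.neutral ballI)
      fix k l
      show "ip q (app (mop (r (k + l))) (x l)) (x k) = 0"
        using v by (auto simp: x_def mult_2)
    qed
    then have "Re (ip (Suc n * q) (app (mop (hankel q r n)) (flat q x)) (flat q x)) = 0"
      by (simp only: ip_hankel[OF car] zero_complex.sel)
    then have "app (mop (hankel q r n)) (flat q x) (j * q + a) = 0"
      using nonneg_form_kernel[OF pos] block_index_less[of j "Suc n" a q] True ij(2) by simp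
    moreover have "app (mop (hankel q r n)) (flat q x) (j * q + a)
        = (\<Sum>k<Suc n. app (mop (r (j + k))) (x k)) a"
      unfolding hankel_def using True ij car by (subst app_block_mat) auto
    moreover have "(\<Sum>k<Suc n. app (mop (r (j + k))) (x k)) = app (mop (r (i + j))) v"
    proof -
      have "(\<Sum>k<Suc n. app (mop (r (j + k))) (x k))
          = (\<Sum>k<Suc n. if k = i then app (mop (r (i + j))) v else 0)"
        by (intro sum.cong) (auto simp: x_def add.commute)
      then show ?thesis using ij(1) by simp
    qed
    ultimately show ?thesis by (simp only: zero_fun_apply)
  next
    case False
    then show ?thesis using car[of "i + j"] ij by (simp add: app_mop)
  qed
qed

text \<open>
  The diagonal block \<open>r\<^sub>2\<^sub>i\<close> annihilates \<open>v\<close>, hence so does the whole block column through it.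
  With \<open>i = (j - 1) div 2\<close> this column reaches \<open>r\<^sub>j\<close>. The last block \<open>r\<^sub>2\<^sub>n\<close> is out of reach:
  it is only met by its own diagonal position.
\<close>

lemma hankel_kernel_propagates:
  assumes q: "1 \<le> q" and car: "\<And>j. j \<le> 2 * n \<Longrightarrow> r j \<in> carrier_mat q q"
    and pos: "nonneg_hermitian (Suc n * q) (hankel q r n)"
    and v: "app (mop (r 0)) v = 0"
  shows "j < 2 * n \<Longrightarrow> app (mop (r j)) v = 0"
proof (induction j rule: less_induct)
  case (less j)
  show ?case
  proof (cases "j = 0")
    case False
    define i where "i = (j - 1) div 2"
    have i: "2 * i < j" "i \<le> n" "j - i \<le> n" "i + (j - i) = j"
      using False less.prems unfolding i_def by linarith+
    have "app (mop (r (2 * i))) v = 0"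
      using less.prems i(1) by (intro less.IH) linarith+
    then have "app (mop (r (i + (j - i)))) v = 0"
      by (intro hankel_column_kernel[of q n r, OF q car pos _ i(2,3)])
    then show ?thesis by (simp only: i(4))
  qed (use v in simp)
qed

text \<open>
  The Hankel matrix of \<open>s\<close> dominates all entries but possibly \<open>s\<^sub>m\<close> for even \<open>m\<close>,
  which is recovered from the Hankel matrix of the shifted sequence. Nothing of the kind holds for
  \<open>s\<^sub>m\<^sub>+\<^sub>1\<close>: for instance \<open>0, S\<close> with any nonnegative \<open>S\<close> belongs to the class.
\<close>

lemma stieltjes_dominated:
  assumes q: "1 \<le> q" and s: "stieltjes_nonneg_fin q (Suc m) \<alpha> s"
    and v: "app (mop (s 0)) v = 0" and j: "j \<le> m"
  shows "app (mop (s j)) v = 0"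
proof -
  define n where "n = Suc m div 2"
  note car = stieltjes_fin_carrier(1)[OF s]
  have H: "nonneg_hermitian (Suc n * q) (hankel q s n)"
    using s by (simp add: stieltjes_nonneg_fin_def Let_def n_def)
  have below: "app (mop (s i)) v = 0" if "i < 2 * n" for i
    using hankel_kernel_propagates[of q n s, OF q _ H v that] car by (simp add: n_def)
  show ?thesis
  proof (cases "j < 2 * n \<or> j = 0")
    case False
    then have n: "j = 2 * n" "Suc m = Suc (2 * n)" "1 \<le> n" using j unfolding n_def by linarith+
    have HS: "nonneg_hermitian (Suc n * q) (hankel q (shifted \<alpha> s) n)"
      using s n(2) by (auto simp: stieltjes_nonneg_fin_def Let_def)
    have shifted: "app (mop (shifted \<alpha> s i)) v
        = app (mop (s (Suc i))) v - app (scal (complex_of_real \<alpha>)) (app (mop (s i)) v)"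
      if "i \<le> 2 * n" for i
      using car[of i] car[of "Suc i"] that n(2) by (simp add: mop_shifted[of s _ q] fun_eq_iff)
    have "app (mop (shifted \<alpha> s 0)) v = 0"
      using shifted[of 0] below[of 0] below[of 1] n(3) by simp
    moreover have "shifted \<alpha> s i \<in> carrier_mat q q" if "i \<le> 2 * n" for i
      using car that n(2) by (intro shifted_carrier) auto
    ultimately have "app (mop (shifted \<alpha> s (2 * n - 1))) v = 0"
      using hankel_kernel_propagates[of q n "shifted \<alpha> s" v "2 * n - 1", OF q _ HS] n(3) by simp
    then show ?thesis
      using shifted[of "2 * n - 1"] below[of "2 * n - 1"] n by simp
  qed (use below v in auto)
qed

section \<open>One step of the Schur algorithm\<close>

lemma reciprocal_cong:
  assumes "\<And>j. j \<le> m \<Longrightarrow> u j = u' j"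
  shows "j \<le> m \<Longrightarrow> reciprocal q u j = reciprocal q u' j"
proof (induction j rule: less_induct)
  case (less j)
  have "(\<Sum>l<j. (u (j - l) * reciprocal q u l) $$ ab) = (\<Sum>l<j. (u' (j - l) * reciprocal q u' l) $$ ab)" for ab
    using less assms by (intro sum.cong) auto
  then show ?case
    using assms[of 0] reciprocal.simps[of q u j] reciprocal.simps[of q u' j] by simp
qed

lemma schur_transform1_cong:
  assumes "\<And>j. j \<le> Suc m \<Longrightarrow> s j = s' j" "j \<le> m"
  shows "schur_transform1 q \<alpha> s j = schur_transform1 q \<alpha> s' j"
proof -
  have "plus_transform q \<alpha> s i = plus_transform q \<alpha> s' i" if "i \<le> Suc m" for i
    using assms(1)[of i] assms(1)[of "i - 1"] that by (simp add: plus_transform_def)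
  then have "reciprocal q (plus_transform q \<alpha> s) (Suc j) = reciprocal q (plus_transform q \<alpha> s') (Suc j)"
    using reciprocal_cong[of "Suc m" "plus_transform q \<alpha> s" "plus_transform q \<alpha> s'"] assms(2) by simp
  then show ?thesis using assms(1)[of 0] by (simp add: schur_transform1_def)
qed

text \<open>
  A finite piece of a sequence may be continued by zeros without affecting its classes or the
  corresponding piece of its Schur transform.
\<close>

lemma hermitian_truncation:
  assumes q: "1 \<le> q" and car: "\<And>j. j \<le> m \<Longrightarrow> s j \<in> carrier_mat q q"
    and sa: "\<And>j. j \<le> m \<Longrightarrow> selfadj q (mop (s j))"
  shows "\<exists>s'. hermitian_sequence q s' \<and> (\<forall>j\<le>m. s j = s' j)"
proof -
  have "mat_adjoint (0\<^sub>m q q) = (0\<^sub>m q q :: complex mat)" by (intro eq_matI) auto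
  moreover have "mat_adjoint (s j) = s j" if "j \<le> m" for j
    using mat_adjoint_eq_self car sa that by blast
  ultimately have "hermitian_sequence q (\<lambda>j. if j \<le> m then s j else 0\<^sub>m q q)"
    using q car by unfold_locales auto
  then show ?thesis by (intro exI[of _ "\<lambda>j. if j \<le> m then s j else 0\<^sub>m q q"]) simp
qed

lemma hankel_kernel_cong:
  assumes "\<forall>j\<le>m. s j = s' j" "2 * n \<le> m"
  shows "psd q (hankel_kernel s) n = psd q (hankel_kernel s') n"
    "pd q (hankel_kernel s) n = pd q (hankel_kernel s') n"
    "degenerate q (hankel_kernel s) n = degenerate q (hankel_kernel s') n"
  using assms by (auto intro!: kernel_property_cong)

lemma shifted_kernel_cong:
  assumes "\<forall>j\<le>m. s j = s' j" "Suc (2 * n) \<le> m"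
  shows "psd q (hankel_kernel (shifted \<alpha> s)) n = psd q (hankel_kernel (shifted \<alpha> s')) n"
    "pd q (hankel_kernel (shifted \<alpha> s)) n = pd q (hankel_kernel (shifted \<alpha> s')) n"
    "degenerate q (hankel_kernel (shifted \<alpha> s)) n = degenerate q (hankel_kernel (shifted \<alpha> s')) n"
  using assms by (auto intro!: kernel_property_cong simp: shifted_def)

text \<open>
  The ordinary and the shifted Hankel matrix exchange their roles: shortening the index by one
  turns the shifted matrix of \<open>s\<close> into the ordinary one of \<open>t\<close>, and the ordinary
  matrix of \<open>s\<close>, after losing its first row and column, into the shifted one of \<open>t\<close>.
\<close>

lemma schur_kernel_transfer:
  fixes q m \<alpha> s
  defines "t \<equiv> schur_transform1 q \<alpha> s"
  assumes q: "1 \<le> q"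
    and car_sa: "\<forall>j\<le>Suc m. s j \<in> carrier_mat q q \<and> selfadj q (mop (s j))"
  shows "\<forall>j\<le>m. t j \<in> carrier_mat q q \<and> selfadj q (mop (t j))"
    and "psd q (hankel_kernel (shifted \<alpha> s)) (m div 2) \<Longrightarrow> psd q (hankel_kernel t) (m div 2)"
    and "1 \<le> m \<Longrightarrow> psd q (hankel_kernel s) (Suc m div 2) \<Longrightarrow>
      psd q (hankel_kernel (shifted \<alpha> t)) ((m - 1) div 2)"
    and "pd q (hankel_kernel s) (Suc m div 2) \<Longrightarrow> pd q (hankel_kernel (shifted \<alpha> s)) (m div 2) \<Longrightarrow>
      pd q (hankel_kernel t) (m div 2)"
    and "1 \<le> m \<Longrightarrow> pd q (hankel_kernel s) (Suc m div 2) \<Longrightarrow>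
      pd q (hankel_kernel (shifted \<alpha> t)) ((m - 1) div 2)"
    and "\<forall>j\<le>m. \<forall>v. app (mop (s 0)) v = 0 \<longrightarrow> app (mop (s j)) v = 0 \<Longrightarrow>
      degenerate q (hankel_kernel (shifted \<alpha> s)) (m div 2) \<Longrightarrow>
      degenerate q (hankel_kernel t) (m div 2)"
    and "\<forall>j\<le>m. \<forall>v. app (mop (s 0)) v = 0 \<longrightarrow> app (mop (s j)) v = 0 \<Longrightarrow>
      1 \<le> m \<Longrightarrow> psd q (hankel_kernel s) (Suc m div 2) \<Longrightarrow>
      degenerate q (hankel_kernel s) (Suc m div 2) \<Longrightarrow>
      degenerate q (hankel_kernel (shifted \<alpha> t)) ((m - 1) div 2)"
proof -
  obtain s' where s': "hermitian_sequence q s'" and eq: "\<forall>j\<le>Suc m. s j = s' j"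
    using hermitian_truncation[of q "Suc m" s, OF q] car_sa by blast
  interpret H: hermitian_sequence q \<alpha> s' by (fact s')
  have teq: "\<forall>j\<le>m. t j = H.t j"
    unfolding assms(1) H.t_def using schur_transform1_cong[of m s s'] eq by blast
  have half: "Suc m div 2 = Suc ((m - 1) div 2)" "Suc (2 * ((m - 1) div 2)) \<le> m" if "1 \<le> m"
    using that by (cases m; simp)+
  have le: "2 * (Suc m div 2) \<le> Suc m" "Suc (2 * (m div 2)) \<le> Suc m" "2 * (m div 2) \<le> m" by simp_all
  note K = hankel_kernel_cong[OF eq le(1)] shifted_kernel_cong[OF eq le(2)]
    hankel_kernel_cong[OF teq le(3)]
  note K' = shifted_kernel_cong[OF teq half(2)]
  have dom: "app (mop (s' j)) v = 0" if "\<forall>j\<le>m. \<forall>v. app (mop (s 0)) v = 0 \<longrightarrow> app (mop (s j)) v = 0" "j \<le> m" "app H.s0 v = 0" for j v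
    using that eq by (simp add: H.s0_def)
  show "\<forall>j\<le>m. t j \<in> carrier_mat q q \<and> selfadj q (mop (t j))"
    using teq H.t_carrier selfadj_mop[OF H.t_carrier H.t_hermitian] by auto
  show "psd q (hankel_kernel (shifted \<alpha> s)) (m div 2) \<Longrightarrow> psd q (hankel_kernel t) (m div 2)"
    unfolding K by (rule H.nonneg_transfer)
  show "psd q (hankel_kernel (shifted \<alpha> t)) ((m - 1) div 2)"
    if "1 \<le> m" "psd q (hankel_kernel s) (Suc m div 2)"
    using that(2) unfolding K K'[OF that(1)] unfolding half(1)[OF that(1)] by (rule H.nonneg_transfer)
  show "pd q (hankel_kernel s) (Suc m div 2) \<Longrightarrow> pd q (hankel_kernel (shifted \<alpha> s)) (m div 2) \<Longrightarrow>
      pd q (hankel_kernel t) (m div 2)"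
    unfolding K by (rule H.pos_transfer)
  show "pd q (hankel_kernel (shifted \<alpha> t)) ((m - 1) div 2)"
    if "1 \<le> m" "pd q (hankel_kernel s) (Suc m div 2)"
    using that(2) unfolding K K'[OF that(1)] unfolding half(1)[OF that(1)] by (blast intro: H.pos_transfer(2))
  show "degenerate q (hankel_kernel t) (m div 2)"
    if "\<forall>j\<le>m. \<forall>v. app (mop (s 0)) v = 0 \<longrightarrow> app (mop (s j)) v = 0"
      and "degenerate q (hankel_kernel (shifted \<alpha> s)) (m div 2)"
    using that(2) unfolding K
    by (intro H.degenerate_transfer(1)[of m "m div 2"] dom[OF that(1)] le(3))
  show "degenerate q (hankel_kernel (shifted \<alpha> t)) ((m - 1) div 2)"
    if "\<forall>j\<le>m. \<forall>v. app (mop (s 0)) v = 0 \<longrightarrow> app (mop (s j)) v = 0"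
      and m: "1 \<le> m" and "psd q (hankel_kernel s) (Suc m div 2)" "degenerate q (hankel_kernel s) (Suc m div 2)"
    using that(3,4) unfolding K K'[OF m] unfolding half(1)[OF m]
    by (intro H.degenerate_transfer(2)[of m "(m - 1) div 2"] dom[OF that(1)] half(2)[OF m])
qed

lemma schur_step:
  assumes q: "1 \<le> q"
  shows "stieltjes_nonneg_fin q (Suc m) \<alpha> s \<Longrightarrow> stieltjes_nonneg_fin q m \<alpha> (schur_transform1 q \<alpha> s)"
    and "stieltjes_pos_fin q (Suc m) \<alpha> s \<Longrightarrow> stieltjes_pos_fin q m \<alpha> (schur_transform1 q \<alpha> s)"
    and "stieltjes_cd_fin q (Suc m) \<alpha> s \<Longrightarrow> stieltjes_cd_fin q m \<alpha> (schur_transform1 q \<alpha> s)"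
proof -
  let ?t = "schur_transform1 q \<alpha> s"
  show nonneg: "stieltjes_nonneg_fin q m \<alpha> ?t" if s: "stieltjes_nonneg_fin q (Suc m) \<alpha> s"
  proof -
    note car = stieltjes_fin_carrier(1)[OF s]
    note iff = stieltjes_fin_iff(1)[of q "Suc m" s \<alpha>, OF q car]
    then have "\<forall>j\<le>Suc m. s j \<in> carrier_mat q q \<and> selfadj q (mop (s j))"
      using s car by blast
    note tr = schur_kernel_transfer[OF q this, of \<alpha>]
    show ?thesis
      using stieltjes_fin_iff(1)[of q m ?t \<alpha>, OF q] tr(1-3) s iff by simp
  qed
  show "stieltjes_pos_fin q m \<alpha> ?t" if s: "stieltjes_pos_fin q (Suc m) \<alpha> s"
  proof -
    note car = stieltjes_fin_carrier(2)[OF s]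
    note iff = stieltjes_fin_iff(2)[of q "Suc m" s \<alpha>, OF q car]
    then have "\<forall>j\<le>Suc m. s j \<in> carrier_mat q q \<and> selfadj q (mop (s j))"
      using s car by blast
    note tr = schur_kernel_transfer[OF q this, of \<alpha>]
    show ?thesis
      using stieltjes_fin_iff(2)[of q m ?t \<alpha>, OF q] tr(1,4,5) s iff by simp
  qed
  show "stieltjes_cd_fin q m \<alpha> ?t" if cd: "stieltjes_cd_fin q (Suc m) \<alpha> s"
  proof -
    have s: "stieltjes_nonneg_fin q (Suc m) \<alpha> s" using cd by (simp add: stieltjes_cd_fin_def)
    note car = stieltjes_fin_carrier(1)[OF s]
    note iff = stieltjes_fin_iff(1)[of q "Suc m" s \<alpha>, OF q car]
    then have "\<forall>j\<le>Suc m. s j \<in> carrier_mat q q \<and> selfadj q (mop (s j))"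
      using s car by blast
    note tr = schur_kernel_transfer[OF q this, of \<alpha>]
    have dom: "\<forall>j\<le>m. \<forall>v. app (mop (s 0)) v = 0 \<longrightarrow> app (mop (s j)) v = 0"
      using stieltjes_dominated[OF q s] by blast
    show ?thesis
    proof (cases "even m")
      case True
      then have "Suc m div 2 = m div 2" by simp
      then show ?thesis
        using tr(6)[OF dom] nonneg[OF s] cd True unfolding stieltjes_cd_fin_iff[OF q] by simp
    next
      case False
      then have "1 \<le> m" "(m - 1) div 2 = m div 2" by (auto elim!: oddE)
      then show ?thesis
        using tr(7)[OF dom] nonneg[OF s] cd False s iff unfolding stieltjes_cd_fin_iff[OF q] by simp
    qed
  qed
qed

text \<open>
  A completely degenerate sequence with the single entry \<open>s\<^sub>0\<close> has \<open>s\<^sub>0 = 0\<close>, and the factor \<open>s\<^sub>0\<close>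
  annihilates the transform. This is why the order of degeneracy stays at \<open>0\<close> once it is there.
\<close>

lemma schur_step_cd_0:
  assumes q: "1 \<le> q" and cd: "stieltjes_cd_fin q 0 \<alpha> s"
  shows "stieltjes_cd_fin q 0 \<alpha> (schur_transform1 q \<alpha> s)"
proof -
  let ?r = "reciprocal q (plus_transform q \<alpha> s) (Suc 0)"
  have s: "stieltjes_nonneg_fin q 0 \<alpha> s" and s0: "s 0 = 0\<^sub>m q q"
    using cd by (auto simp: stieltjes_cd_fin_def hankel_schur_def)
  have "mat_adjoint (0\<^sub>m q q) = (0\<^sub>m q q :: complex mat)" by (intro eq_matI) auto
  then have "mp_inverse (0\<^sub>m q q) \<in> carrier_mat q q" by (intro mp_inverse_hermitian) auto
  moreover have "plus_transform q \<alpha> s 0 = 0\<^sub>m q q" by (simp add: plus_transform_def s0)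
  ultimately have "?r \<in> carrier_mat q q" by (subst reciprocal.simps) simp
  moreover have "- 0\<^sub>m q q = (0\<^sub>m q q :: complex mat)" by (intro eq_matI) auto
  ultimately have t0: "schur_transform1 q \<alpha> s 0 = 0\<^sub>m q q"
    by (simp add: schur_transform1_def s0)
  have "stieltjes_nonneg_fin q 0 \<alpha> (schur_transform1 q \<alpha> s)"
    by (rule stieltjes_nonneg_fin_cong[OF q _ s]) (simp add: s0 t0)
  then show ?thesis using t0 by (simp add: stieltjes_cd_fin_def hankel_schur_def)
qed

section \<open>Iterated Schur transforms\<close>

lemma schur_transform_nonneg_fin:
  assumes q: "1 \<le> q"
  shows "stieltjes_nonneg_fin q (m + k) \<alpha> s \<Longrightarrow> stieltjes_nonneg_fin q m \<alpha> (schur_transform q \<alpha> k s)"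
  by (induction k arbitrary: m) (auto intro: schur_step(1)[OF q] simp flip: add_Suc)

lemma schur_transform_pos_fin:
  assumes q: "1 \<le> q"
  shows "stieltjes_pos_fin q (m + k) \<alpha> s \<Longrightarrow> stieltjes_pos_fin q m \<alpha> (schur_transform q \<alpha> k s)"
  by (induction k arbitrary: m) (auto intro: schur_step(2)[OF q] simp flip: add_Suc)

lemma schur_transform_cd_fin:
  assumes q: "1 \<le> q" and "stieltjes_cd_fin q m \<alpha> s"
  shows "stieltjes_cd_fin q (m - k) \<alpha> (schur_transform q \<alpha> k s)"
proof (induction k)
  case (Suc k)
  then show ?case
    using schur_step(3)[OF q, of "m - Suc k"] schur_step_cd_0[OF q]
    by (cases "k < m") (auto simp: Suc_diff_Suc)
qed (use assms in simp)

lemma schur_transform_cong: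
  assumes "\<And>j. j \<le> m + k \<Longrightarrow> s j = s' j" "j \<le> m"
  shows "schur_transform q \<alpha> k s j = schur_transform q \<alpha> k s' j"
  using assms
proof (induction k arbitrary: m j)
  case (Suc k)
  have "schur_transform q \<alpha> k s i = schur_transform q \<alpha> k s' i" if "i \<le> Suc m" for i
    using Suc.IH[of "Suc m" i] Suc.prems(1) that by simp
  then show ?case
    using schur_transform1_cong[of m "schur_transform q \<alpha> k s" "schur_transform q \<alpha> k s'" j] Suc.prems(2)
    by simp
qed simp

lemma schur_transform_nonneg:
  assumes q: "1 \<le> q" and k: "enat k \<le> \<kappa>" and s: "stieltjes_nonneg q \<kappa> \<alpha> s"
  shows "stieltjes_nonneg q (\<kappa> - enat k) \<alpha> (schur_transform q \<alpha> k s)"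
proof (cases \<kappa>)
  case (enat m)
  then show ?thesis using schur_transform_nonneg_fin[OF q, of "m - k" k \<alpha> s] s k
    by (simp add: stieltjes_nonneg_def)
next
  case infinity
  then show ?thesis using schur_transform_nonneg_fin[OF q] s by (simp add: stieltjes_nonneg_def)
qed

lemma schur_transform_pos:
  assumes q: "1 \<le> q" and k: "enat k \<le> \<kappa>" and s: "stieltjes_pos q \<kappa> \<alpha> s"
  shows "stieltjes_pos q (\<kappa> - enat k) \<alpha> (schur_transform q \<alpha> k s)"
proof (cases \<kappa>)
  case (enat m)
  then show ?thesis using schur_transform_pos_fin[OF q, of "m - k" k \<alpha> s] s k
    by (simp add: stieltjes_pos_def)
next
  case infinity
  then show ?thesis using schur_transform_pos_fin[OF q] s by (simp add: stieltjes_pos_def)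
qed

text \<open>
  The extension of the transformed sequence is the next transformed entry of the
  extended sequence; the earlier entries do not depend on the extension.
\<close>

lemma schur_transform_nonneg_ext:
  assumes q: "1 \<le> q" and k: "enat k \<le> \<kappa>" and s: "stieltjes_nonneg_ext q \<kappa> \<alpha> s"
  shows "stieltjes_nonneg_ext q (\<kappa> - enat k) \<alpha> (schur_transform q \<alpha> k s)"
proof (cases \<kappa>)
  case (enat m)
  then have km: "k \<le> m" using k by simp
  obtain X where X: "stieltjes_nonneg_fin q (Suc m) \<alpha> (s(Suc m := X))"
    using s enat by (auto simp: stieltjes_nonneg_ext_def)
  define t' where "t' = schur_transform q \<alpha> k (s(Suc m := X))"
  have t': "stieltjes_nonneg_fin q (Suc (m - k)) \<alpha> t'"
    unfolding t'_def using km X by (intro schur_transform_nonneg_fin[OF q]) simp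
  let ?t = "(schur_transform q \<alpha> k s)(Suc (m - k) := t' (Suc (m - k)))"
  have "t' j = ?t j" if "j \<le> Suc (m - k)" for j
    using that km schur_transform_cong[of "m - k" k "s(Suc m := X)" s j q \<alpha>]
    by (auto simp: t'_def)
  then have "stieltjes_nonneg_fin q (Suc (m - k)) \<alpha> ?t"
    by (rule stieltjes_nonneg_fin_cong[OF q _ t'])
  then show ?thesis
    using stieltjes_fin_carrier(1)[OF t', of "Suc (m - k)"] enat by (auto simp: stieltjes_nonneg_ext_def)
next
  case infinity
  then show ?thesis
    using schur_transform_nonneg[OF q, of k \<infinity>] s by (simp add: stieltjes_nonneg_ext_def)
qed

theorem theorem8p10:
  fixes q k :: nat and \<alpha> :: real and \<kappa> :: enat and s :: "nat \<Rightarrow> complex mat"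
  assumes "1 \<le> q"
    and "\<And>j. enat j \<le> \<kappa> \<Longrightarrow> s j \<in> carrier_mat q q"
    and "enat k \<le> \<kappa>"
  shows "(stieltjes_nonneg q \<kappa> \<alpha> s \<longrightarrow>
            stieltjes_nonneg q (\<kappa> - enat k) \<alpha> (schur_transform q \<alpha> k s)) \<and>
         (stieltjes_nonneg_ext q \<kappa> \<alpha> s \<longrightarrow>
            stieltjes_nonneg_ext q (\<kappa> - enat k) \<alpha> (schur_transform q \<alpha> k s)) \<and>
         (stieltjes_pos q \<kappa> \<alpha> s \<longrightarrow>
            stieltjes_pos q (\<kappa> - enat k) \<alpha> (schur_transform q \<alpha> k s)) \<and>
         (\<forall>m. enat m \<le> \<kappa> \<longrightarrow> stieltjes_cd_order q m \<kappa> \<alpha> s \<longrightarrow>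
            stieltjes_cd_order q (m - k) (\<kappa> - enat k) \<alpha> (schur_transform q \<alpha> k s)) \<and>
         (stieltjes_cd q \<kappa> \<alpha> s \<longrightarrow>
            stieltjes_cd q (\<kappa> - enat k) \<alpha> (schur_transform q \<alpha> k s))"
proof (intro conjI impI allI)
  note q = assms(1) and k = assms(3)
  note nonneg = schur_transform_nonneg[OF q k] and cd = schur_transform_cd_fin[OF q]
  show "stieltjes_nonneg q \<kappa> \<alpha> s \<Longrightarrow> stieltjes_nonneg q (\<kappa> - enat k) \<alpha> (schur_transform q \<alpha> k s)"
    by (rule nonneg)
  show "stieltjes_nonneg_ext q \<kappa> \<alpha> s \<Longrightarrow> stieltjes_nonneg_ext q (\<kappa> - enat k) \<alpha> (schur_transform q \<alpha> k s)"
    by (rule schur_transform_nonneg_ext[OF q k])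
  show "stieltjes_pos q \<kappa> \<alpha> s \<Longrightarrow> stieltjes_pos q (\<kappa> - enat k) \<alpha> (schur_transform q \<alpha> k s)"
    by (rule schur_transform_pos[OF q k])
  show "stieltjes_cd_order q (m - k) (\<kappa> - enat k) \<alpha> (schur_transform q \<alpha> k s)"
    if "stieltjes_cd_order q m \<kappa> \<alpha> s" for m
    using that nonneg cd by (simp add: stieltjes_cd_order_def)
  show "stieltjes_cd q (\<kappa> - enat k) \<alpha> (schur_transform q \<alpha> k s)"
    if s: "stieltjes_cd q \<kappa> \<alpha> s"
  proof (cases \<kappa>)
    case (enat m)
    then show ?thesis using s cd by (simp add: stieltjes_cd_def)
  next
    case infinity
    then obtain m where "stieltjes_cd_fin q m \<alpha> s" "stieltjes_nonneg q \<infinity> \<alpha> s"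
      using s by (auto simp: stieltjes_cd_def)
    then show ?thesis using cd[of m \<alpha> s k] nonneg infinity by (auto simp: stieltjes_cd_def)
  qed
qed

end
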